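(* Let $X=(X_n)_{n\in\mathbb{N}}$ be the Harris chain and let $X_\infty$ be its almost sure Doob-Martin limit. Let $$Y_\infty:=\sum_{u\in\mathbb{V}}X_\infty(A_u)\,C\bigl(\rho(X_\infty,u)\bigr).$$ Then, as $n\to\infty$, $$\frac1n\,\mathrm{TPL}(X_n)-H_n+1\;\to\;Y_\infty,$$ almost surely and in $L^p$ for every $p>0$.
   Context: $\mathbb{N}=\{1,2,\ldots\}$ and $\mathbb{V}=\mathbb{N}^\star$ is the set of finite sequences of natural numbers (including the empty sequence $\emptyset$); $u+v$ denotes concatenation and $ui:=u+(i)$. For $u=(u_1,\ldots,u_l)\in\mathbb{V}$, $|u|:=l$ and $|u|_1:=\sum_{i=1}^l u_i$. A Harris tree is a finite nonempty set $x\subset\mathbb{V}$ such that (i) $u+v\in x$ implies $u\in x$, and (ii) $ui\in x$ with $i>1$ implies $uj\in x$ for $1\le j\le i-1$. $\mathbb{H}_n$ is the set of Harris trees with $n$ nodes. For a Harris tree $x$, $x(u):=\{v\in\mathbb{V}:u+v\in x\}$. The Harris chain $X=(X_n)_{n\in\mathbb{N}}$ is the Markov chain with $X_1=\{\emptyset\}$ and, for $x_n\in\mathbb{H}_n$, $x_{n+1}\in\mathbb{H}_{n+1}$, $P(X_{n+1}=x_{n+1}\mid X_n=x_n)=1/n$ if $x_n\subset x_{n+1}$ and $0$ otherwise. (It is the image of the chain of random recursive trees, where each new node chooses its ancestor uniformly at random.) The total path length of a Harris tree $x$ is $\mathrm{TPL}(x):=\sum_{u\in x}|u|$. $H_n:=\sum_{k=1}^n\frac1k$.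 $\bar{\mathbb{V}}:=\mathbb{N}^\star\sqcup\mathbb{N}^\infty\sqcup\bigsqcup_{k=0}^\infty\mathbb{N}^k\times\{\infty\}^\infty$; $A_u:=\{v\in\bar{\mathbb{V}}: u\text{ is a prefix of }v\}$ for $u\in\mathbb{V}$; $\mathcal{V}$ is the $\sigma$-field generated by the sets $A_u$, $u\in\mathbb{V}$. $X_\infty$ is the random probability measure on $(\bar{\mathbb{V}},\mathcal{V})$ with, almost surely, $X_\infty(A_u)=\lim_{n\to\infty}\frac1n\#X_n(u)$ for all $u\in\mathbb{V}$ (it is known that this limit exists almost surely). $\Sigma_\infty$ is the set of sequences $(s_i)_{i\in\mathbb{N}}$ with $s_i\ge0$ and $\sum_{i=1}^\infty s_i=1$. For $u\in\mathbb{V}$, $\rho(X_\infty,u)=(\rho_i(X_\infty,u))_{i\in\mathbb{N}}$ with $\rho_i(X_\infty,u):=X_\infty(A_{ui})/X_\infty(A_u)$, which is almost surely a well-defined element of $\Sigma_\infty$. The function $C:\Sigma_\infty\to[-\infty,1]$ is $C\bigl((s_i)_{i\in\mathbb{N}}\bigr):=1+\sum_{i=1}^\infty s_i\log s_i$ (with $0\log0:=0$). The infinite sum defining $Y_\infty$ is understood as the limit, in $L^p$ for all $p\ge1$, of the partial sums over $\{u\in\mathbb{V}:|u|_1\le k\}$ as $k\to\infty$ (this limit exists). *)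

theory Defs
  imports "HOL-Probability.Probability" "HOL-Library.Sublist"
begin

(* Natural numbers start at 1 here, so nodes are lists of positive naturals;
   |u| is length u and |u|_1 is sum_list u. *)
definition nodes :: "nat list set" where
  "nodes = {u. \<forall>i\<in>set u. 1 \<le> i}"

definition harris_tree :: "nat list set \<Rightarrow> bool" where
  "harris_tree x \<longleftrightarrow> finite x \<and> x \<noteq> {} \<and> x \<subseteq> nodes \<and>
     (\<forall>u v. u @ v \<in> x \<longrightarrow> u \<in> x) \<and>
     (\<forall>u i. u @ [i] \<in> x \<longrightarrow> i > 1 \<longrightarrow> (\<forall>j\<in>{1..i - 1}. u @ [j] \<in> x))"

definition harris_trees :: "nat \<Rightarrow> nat list set set" where
  "harris_trees n = {x. harris_tree x \<and> card x = n}"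

definition subtree :: "nat list set \<Rightarrow> nat list \<Rightarrow> nat list set" where
  "subtree x u = {v \<in> nodes. u @ v \<in> x}"

definition TPL :: "nat list set \<Rightarrow> nat" where
  "TPL x = (\<Sum>u\<in>x. length u)"

(* The chain is indexed by n \<ge> 1; X 0 is unconstrained.
   X 1 = {[]} needs no separate clause, because {[]} is the only tree with one node,
   but is stated for definiteness. The last clause is the Markov property together with the
   transition probabilities: conditioning is on every history of positive probability. *)
definition harris_chain :: "'w measure \<Rightarrow> (nat \<Rightarrow> 'w \<Rightarrow> nat list set) \<Rightarrow> bool" where
  "harris_chain M X \<longleftrightarrow> prob_space M \<and>
     (\<forall>n\<ge>1. X n \<in> M \<rightarrow>\<^sub>M count_space (harris_trees n)) \<and>
     (\<forall>\<omega>\<in>space M. X 1 \<omega> = {[]}) \<and>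
     (\<forall>n\<ge>1. \<forall>x. (\<forall>i\<in>{1..n + 1}. x i \<in> harris_trees i) \<longrightarrow>
        \<P>(\<omega> in M. \<forall>i\<in>{1..n}. X i \<omega> = x i) > 0 \<longrightarrow>
        \<P>(\<omega> in M. X (n + 1) \<omega> = x (n + 1) \<bar> \<forall>i\<in>{1..n}. X i \<omega> = x i)
          = (if x n \<subseteq> x (n + 1) then 1 / real n else 0))"

(* The points of the compactification: Fin u is a finite sequence u, Inf s is the infinite
   sequence s 0, s 1, ..., and Cut u is u followed by infinity, infinity, .... *)
datatype vbar = Fin "nat list" | Inf "nat \<Rightarrow> nat" | Cut "nat list"

definition Vbar :: "vbar set" where
  "Vbar = Fin ` nodes \<union> Inf ` {s. \<forall>i. 1 \<le> s i} \<union> Cut ` nodes"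

(* The entries of a node are finite, so a node that is a prefix of Cut v is a prefix of v. *)
fun is_prefix :: "nat list \<Rightarrow> vbar \<Rightarrow> bool" where
  "is_prefix u (Fin v) = prefix u v"
| "is_prefix u (Inf s) = (\<forall>i<length u. u ! i = s i)"
| "is_prefix u (Cut v) = prefix u v"

definition cyl :: "nat list \<Rightarrow> vbar set" where
  "cyl u = {v \<in> Vbar. is_prefix u v}"

definition Vbar_algebra :: "vbar measure" where
  "Vbar_algebra = sigma Vbar (cyl ` nodes)"

(* A random probability measure is a measurable map into the space of probability measures. *)
definition doob_martin_limit ::
    "'w measure \<Rightarrow> (nat \<Rightarrow> 'w \<Rightarrow> nat list set) \<Rightarrow> ('w \<Rightarrow> vbar measure) \<Rightarrow> bool" where
  "doob_martin_limit M X Xinf \<longleftrightarrow> Xinf \<in> M \<rightarrow>\<^sub>M prob_algebra Vbar_algebra \<and>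
     (AE \<omega> in M. \<forall>u\<in>nodes.
        (\<lambda>n. real (card (subtree (X n \<omega>) u)) / real n) \<longlonglongrightarrow> measure (Xinf \<omega>) (cyl u))"

definition rho :: "vbar measure \<Rightarrow> nat list \<Rightarrow> nat \<Rightarrow> real" where
  "rho \<mu> u i = measure \<mu> (cyl (u @ [i])) / measure \<mu> (cyl u)"

(* Sequences are indexed by i \<ge> 1, hence the shift. For entries in [0,1] all terms are
   nonpositive, so the series always converges in ereal, possibly to -\<infinity>. *)
definition C_fun :: "(nat \<Rightarrow> real) \<Rightarrow> ereal" where
  "C_fun s = 1 + (\<Sum>i. ereal (s (Suc i) * ln (s (Suc i))))"

definition Y_partial :: "vbar measure \<Rightarrow> nat \<Rightarrow> ereal" where
  "Y_partial \<mu> k =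
     (\<Sum>u\<in>{u \<in> nodes. sum_list u \<le> k}. ereal (measure \<mu> (cyl u)) * C_fun (rho \<mu> u))"

lemma finite_nodes_sum_le: "finite {u \<in> nodes. sum_list u \<le> k}"
proof (rule finite_subset)
  have len: "length u \<le> sum_list u" if "u \<in> nodes" for u
    using that unfolding nodes_def by (induction u) auto
  show "{u \<in> nodes. sum_list u \<le> k} \<subseteq> {u. set u \<subseteq> {..k} \<and> length u \<le> k}"
    using len by (auto intro: order_trans member_le_sum_list)
  show "finite {u. set u \<subseteq> {..k} \<and> length u \<le> k}"
    by (rule finite_lists_length_le) simp
qed

(* For 0 < p < 1 this is convergence in the metric E |f - g|^p. *)
definition tendsto_Lp ::
    "'w measure \<Rightarrow> real \<Rightarrow> (nat \<Rightarrow> 'w \<Rightarrow> real) \<Rightarrow> ('w \<Rightarrow> real) \<Rightarrow> bool" where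
  "tendsto_Lp M p f g \<longleftrightarrow>
     (\<forall>n. f n \<in> borel_measurable M \<and> integrable M (\<lambda>\<omega>. \<bar>f n \<omega>\<bar> powr p)) \<and>
     g \<in> borel_measurable M \<and> integrable M (\<lambda>\<omega>. \<bar>g \<omega>\<bar> powr p) \<and>
     (\<lambda>n. \<integral>\<omega>. \<bar>f n \<omega> - g \<omega>\<bar> powr p \<partial>M) \<longlonglongrightarrow> 0"

(* The sum over all nodes, as a limit in L^p for all p \<ge> 1, determined up to null sets.
   The partial sums are almost surely finite, so real_of_ereal only discards a null set. *)
definition is_Y_infinity :: "'w measure \<Rightarrow> ('w \<Rightarrow> vbar measure) \<Rightarrow> ('w \<Rightarrow> real) \<Rightarrow> bool" where
  "is_Y_infinity M Xinf Y \<longleftrightarrow>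
     (\<forall>p\<ge>1. tendsto_Lp M p (\<lambda>k \<omega>. real_of_ereal (Y_partial (Xinf \<omega>) k)) Y)"

end

theory Submission imports Defs "HOL-Real_Asymp.Real_Asymp"
begin

text \<open>
  Write \<open>N u\<close> for the number of nodes of the tree that lie weakly below \<open>u\<close>, \<open>H\<close> for the harmonic
  numbers and \<open>K m = m * H m\<close>. Every tree \<open>x\<close> with \<open>n\<close> nodes has exactly \<open>n\<close> extensions, one for each
  choice of a parent \<open>v \<in> x\<close> of the new node (\<open>bij_betw_grow\<close>), and the chain picks one of them
  uniformly. Hence, if a function \<open>f\<close> of trees satisfies
  \<open>(\<Sum>v\<in>x. f (grow x v) - f x) = f x\<close>, the process \<open>f (X n) / n\<close> is a martingale. Two kinds of
  functions have this property: the centred path length \<open>TPL x + n - K n\<close>, whose martingale is the process of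
  the theorem, and, for every node \<open>u\<close>, the toll \<open>N u - K (N u) + (\<Sum>i. K (N (u @ [i])))\<close>.

  Divided by \<open>n\<close>, the toll at \<open>u\<close> is the finite counterpart of the summand of \<open>Y\<close> that belongs to \<open>u\<close>. Indeed, if
  \<open>u \<in> x\<close>, the children of \<open>u\<close> have \<open>N u - 1\<close> nodes weakly below them in total, so the toll equals
  \<open>N u - H (N u) - (\<Sum>i. N (u @ [i]) * (H (N u) - H (N (u @ [i]))))\<close>, and differences of harmonic
  numbers behave like differences of logarithms.

  Subtract from the centred path length the tolls at all nodes with \<open>sum_list u < k\<close>. What remains, the
  residual, is the sum of the centred path lengths of the subtrees that hang off these nodes.
  The changes of the tolls along an ancestral line telescope, so the increment of the residual is
  bounded, uniformly in \<open>k\<close>, by the maximum of \<open>H n\<close> and the depth of the new node; and it vanishes as long as \<open>n \<le> k\<close>,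
  because \<open>sum_list u < n\<close> for all nodes of a tree of size \<open>n\<close>. The average squared depth has
  an expectation of order \<open>(ln n)\<^sup>2\<close>; orthogonality of martingale increments therefore gives a rate of order
  \<open>(ln n)\<^sup>2 / n\<close> both for the squared \<open>L\<^sup>2\<close> distance between the martingale at time \<open>n\<close> and at any later
  time (\<open>R_increment_L2\<close>) and, with \<open>k\<close> in place of \<open>n\<close>, for the squared \<open>L\<^sup>2\<close> norm of the residual
  divided by the size of the tree (\<open>R_L2\<close>).

  The toll is an infinite series in the limit. It is truncated after \<open>L\<close> children; the expected
  error is small uniformly in \<open>n\<close> (\<open>expectation_entropy_term_tail\<close>). Fatou's lemma, used for
  a later time \<open>m \<rightarrow> \<infinity>\<close> and then for \<open>L \<rightarrow> \<infinity>\<close>, bounds the \<open>L\<^sup>1\<close> distance between the martingale at time \<open>n\<close> and a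
  partial sum of the limit (\<open>nn_integral_Y_partial\<close>), and \<open>k \<rightarrow> \<infinity>\<close> yields an explicit bound for the
  \<open>L\<^sup>1\<close> distance between the martingale and \<open>Y\<close> (\<open>R_L1\<close>).

  Both modes of convergence follow from this bound. Along the times \<open>k ^ 6\<close> the \<open>L\<^sup>1\<close> distances are
  summable, so there is almost sure convergence, and monotonicity of the path length covers the
  times in between (\<open>monotone_interpolation\<close>). The martingale is closed by \<open>Y\<close>, so by convexity its
  even moments are bounded by those of \<open>Y\<close> (\<open>R_moment_le\<close>), and \<open>L\<^sup>1\<close> convergence together with
  bounded moments of all orders implies \<open>L\<^sup>p\<close> convergence for all \<open>p > 0\<close>.
\<close>

section \<open>Harris trees and their extensions\<close>

lemma harris_trees_iff: "x \<in> harris_trees n \<longleftrightarrow> harris_tree x \<and> card x = n"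
  by (simp add: harris_trees_def)

lemma harris_tree_Nil: "harris_tree x \<Longrightarrow> [] \<in> x"
  unfolding harris_tree_def by (metis all_not_in_conv append_Nil)

lemma harris_tree_prefix: "harris_tree x \<Longrightarrow> v \<in> x \<Longrightarrow> prefix u v \<Longrightarrow> u \<in> x"
  unfolding harris_tree_def prefix_def by blast

lemma harris_tree_finite: "harris_tree x \<Longrightarrow> finite x"
  by (simp add: harris_tree_def)

lemma harris_tree_nodes: "harris_tree x \<Longrightarrow> u \<in> x \<Longrightarrow> u \<in> nodes"
  by (auto simp: harris_tree_def)

lemma nodes_snoc: "u @ [i] \<in> nodes \<longleftrightarrow> u \<in> nodes \<and> 1 \<le> i"
  by (auto simp: nodes_def)

lemma harris_tree_sibling:
  "harris_tree x \<Longrightarrow> u @ [i] \<in> x \<Longrightarrow> 1 \<le> j \<Longrightarrow> j \<le> i \<Longrightarrow> u @ [j] \<in> x"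
proof (cases "j = i")
  case False
  assume "harris_tree x" "u @ [i] \<in> x" "1 \<le> j" "j \<le> i"
  moreover have "j \<in> {1..i - 1}" "i > 1" using False calculation by auto
  ultimately show ?thesis unfolding harris_tree_def by blast
qed simp

text \<open>
  Replacing a last entry \<open>i > 1\<close> by \<open>i - 1\<close>, or deleting a last entry 1, lowers the sum of the entries by one
  and stays inside the tree.
\<close>

lemma sum_list_attained:
  assumes "harris_tree x"
  shows "u \<in> x \<Longrightarrow> s \<le> sum_list u \<Longrightarrow> \<exists>w\<in>x. sum_list w = s"
proof (induction "sum_list u" arbitrary: u)
  case 0
  then show ?case by (metis le_0_eq)
next
  case (Suc m)
  show ?case
  proof (cases "s = sum_list u")
    case True
    then show ?thesis using Suc.prems by auto
  next
    case False
    have "u \<noteq> []" using Suc.hyps(2) by auto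
    then obtain v i where u: "u = v @ [i]" by (cases u rule: rev_cases) auto
    have i: "1 \<le> i" using harris_tree_nodes[OF assms Suc.prems(1)] u by (simp add: nodes_snoc)
    define w where "w = (if i = 1 then v else v @ [i - 1])"
    have "w \<in> x"
      using harris_tree_prefix[OF assms Suc.prems(1), of v]
        harris_tree_sibling[OF assms, of v i "i - 1"] Suc.prems(1) u i
      by (auto simp: w_def)
    moreover have "sum_list u = Suc (sum_list w)"
      using i u by (auto simp: w_def)
    ultimately show ?thesis
      using Suc.hyps(1)[of w] Suc.hyps(2) Suc.prems(2) False by auto
  qed
qed

text \<open>
  This makes the set of Harris trees of a given size finite, and it shows that a node \<open>u\<close> cannot be
  present before time \<open>sum_list u + 1\<close>.
\<close>

lemma sum_list_less_card:
  assumes "harris_tree x" "u \<in> x"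
  shows "sum_list u < card x"
proof -
  have "{..sum_list u} \<subseteq> sum_list ` x"
    using sum_list_attained[OF assms] by (metis atMost_iff image_iff subsetI)
  then have "card {..sum_list u} \<le> card x"
    using harris_tree_finite[OF assms(1)] by (meson card_image_le card_mono finite_imageI order_trans)
  then show ?thesis by simp
qed

lemma finite_harris_trees: "finite (harris_trees n)"
proof (rule finite_subset)
  show "harris_trees n \<subseteq> Pow {u \<in> nodes. sum_list u \<le> n}"
    using sum_list_less_card harris_tree_nodes
    by (fastforce simp: harris_trees_iff intro: less_imp_le)
qed (simp add: finite_nodes_sum_le)

definition num_children :: "nat list set \<Rightarrow> nat list \<Rightarrow> nat" where
  "num_children x u = card {i. u @ [i] \<in> x}"

lemma snoc_mem_less_card:
  assumes "harris_tree x" "u @ [i] \<in> x" shows "i < card x"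
  using sum_list_less_card[OF assms] by simp

lemma children_eq:
  assumes "harris_tree x"
  shows "{i. u @ [i] \<in> x} = {1..num_children x u}"
proof -
  let ?I = "{i. u @ [i] \<in> x}"
  have fin: "finite ?I"
    by (rule finite_subset[of _ "{..<card x}"]) (auto intro: snoc_mem_less_card[OF assms])
  show ?thesis
  proof (cases "?I = {}")
    case True
    then show ?thesis by (simp add: num_children_def)
  next
    case False
    have "?I = {1..Max ?I}"
    proof (intro equalityI subsetI)
      fix i assume i: "i \<in> ?I"
      then have "u @ [i] \<in> nodes" using harris_tree_nodes[OF assms] by auto
      then show "i \<in> {1..Max ?I}" using i fin by (simp add: nodes_snoc)
    next
      fix j assume "j \<in> {1..Max ?I}"
      moreover have "u @ [Max ?I] \<in> x" using Max_in[OF fin False] by simp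
      ultimately show "j \<in> ?I" using harris_tree_sibling[OF assms] by auto
    qed
    then show ?thesis unfolding num_children_def by (metis card_atLeastAtMost diff_Suc_1)
  qed
qed

lemma snoc_mem_iff: "harris_tree x \<Longrightarrow> u @ [i] \<in> x \<longleftrightarrow> 1 \<le> i \<and> i \<le> num_children x u"
  using children_eq[of x u] by (metis atLeastAtMost_iff mem_Collect_eq)

lemma num_children_less_card: "harris_tree x \<Longrightarrow> num_children x u < card x"
  using snoc_mem_iff[of x u "num_children x u"] snoc_mem_less_card[of x u "num_children x u"]
  by (cases "num_children x u = 0") (auto simp: harris_tree_def card_gt_0_iff)

definition new_node :: "nat list set \<Rightarrow> nat list \<Rightarrow> nat list" where
  "new_node x v = v @ [Suc (num_children x v)]"

definition grow :: "nat list set \<Rightarrow> nat list \<Rightarrow> nat list set" where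
  "grow x v = insert (new_node x v) x"

lemma new_node_notin: "harris_tree x \<Longrightarrow> new_node x v \<notin> x"
  by (simp add: new_node_def snoc_mem_iff)

lemma card_grow: "harris_tree x \<Longrightarrow> card (grow x v) = Suc (card x)"
  by (simp add: grow_def new_node_notin harris_tree_finite)

lemma harris_tree_grow:
  assumes "harris_tree x" "v \<in> x"
  shows "harris_tree (grow x v)"
  unfolding harris_tree_def
proof (intro conjI allI impI ballI)
  show "finite (grow x v)" "grow x v \<noteq> {}"
    using harris_tree_finite[OF assms(1)] by (auto simp: grow_def)
  show "grow x v \<subseteq> nodes"
    using harris_tree_nodes[OF assms(1)] assms(2) by (auto simp: grow_def new_node_def nodes_snoc)
next
  fix a b assume "a @ b \<in> grow x v"
  then consider "a @ b \<in> x" | "a @ b = v @ [Suc (num_children x v)]"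
    by (auto simp: grow_def new_node_def)
  then show "a \<in> grow x v"
  proof cases
    case 1
    then show ?thesis using harris_tree_prefix[OF assms(1)] by (auto simp: grow_def)
  next
    case 2
    then have "prefix a (v @ [Suc (num_children x v)])" by (metis prefixI)
    then show ?thesis using harris_tree_prefix[OF assms]
      by (auto simp: grow_def new_node_def)
  qed
next
  fix u i j assume "u @ [i] \<in> grow x v" "1 < i" "j \<in> {1..i-1}"
  then show "u @ [j] \<in> grow x v"
    using harris_tree_sibling[OF assms(1), of u i j]
    by (auto simp: grow_def new_node_def snoc_mem_iff[OF assms(1)])
qed

lemma grow_mem: "x \<in> harris_trees n \<Longrightarrow> v \<in> x \<Longrightarrow> grow x v \<in> harris_trees (Suc n)"
  by (simp add: harris_trees_iff harris_tree_grow card_grow)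

text \<open>
  The node added by an extension must be the first missing child of its parent. Together with the
  transition probabilities \<open>1 / n\<close> this says that the parent is chosen uniformly.
\<close>

lemma bij_betw_grow:
  assumes "x \<in> harris_trees n"
  shows "bij_betw (grow x) x {y \<in> harris_trees (Suc n). x \<subseteq> y}"
proof -
  have x: "harris_tree x" "card x = n" using assms by (auto simp: harris_trees_iff)
  note fin = harris_tree_finite[OF x(1)]
  show ?thesis
  proof (rule bij_betw_imageI)
    show "inj_on (grow x) x"
      using new_node_notin[OF x(1)]
      by (auto simp: inj_on_def grow_def new_node_def)
    show "grow x ` x = {y \<in> harris_trees (Suc n). x \<subseteq> y}"
    proof (intro equalityI subsetI)
      fix y assume "y \<in> grow x ` x"
      then show "y \<in> {y \<in> harris_trees (Suc n). x \<subseteq> y}"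
        using grow_mem[OF assms] by (auto simp: grow_def)
    next
      fix y assume "y \<in> {y \<in> harris_trees (Suc n). x \<subseteq> y}"
      then have y: "harris_tree y" "card y = Suc n" "x \<subseteq> y" by (auto simp: harris_trees_iff)
      have "card (y - x) = 1"
        using y x fin by (simp add: card_Diff_subset)
      then obtain w where w: "y - x = {w}" by (auto simp: card_1_singleton_iff)
      then have yw: "y = insert w x" "w \<notin> x" using y(3) by auto
      have "w \<noteq> []" using harris_tree_Nil[OF x(1)] yw(2) by auto
      then obtain v i where vi: "w = v @ [i]" by (cases w rule: rev_cases) auto
      have "v \<in> y" using harris_tree_prefix[OF y(1), of w v] yw vi by auto
      then have v: "v \<in> x" using yw vi by auto
      have i: "1 \<le> i" using harris_tree_nodes[OF y(1), of w] yw vi by (simp add: nodes_snoc)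
      have "{1..num_children x v} = {1..<i}"
      proof (intro equalityI subsetI)
        fix j assume j: "j \<in> {1..<i}"
        then have "v @ [j] \<in> y" using harris_tree_sibling[OF y(1), of v i j] yw vi by auto
        then have "v @ [j] \<in> x" using yw vi j by auto
        then show "j \<in> {1..num_children x v}" using snoc_mem_iff[OF x(1)] by auto
      next
        fix j assume j: "j \<in> {1..num_children x v}"
        then have "v @ [j] \<in> x" using snoc_mem_iff[OF x(1)] by auto
        then have "\<not> i \<le> j" using harris_tree_sibling[OF x(1), of v j i] i yw vi by auto
        then show "j \<in> {1..<i}" using j by auto
      qed
      then have "card {1..num_children x v} = card {1..<i}" by simp
      then have "i = Suc (num_children x v)" using i by simp
      then have "y = grow x v" using yw vi by (simp add: grow_def new_node_def)
      then show "y \<in> grow x ` x" using v by auto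
    qed
  qed
qed

section \<open>Subtree sizes\<close>

definition weight :: "nat list set \<Rightarrow> nat list \<Rightarrow> nat" where
  "weight x u = card {v \<in> x. prefix u v}"

lemma card_subtree:
  assumes "harris_tree x" shows "card (subtree x u) = weight x u"
proof -
  have "bij_betw ((@) u) (subtree x u) {v \<in> x. prefix u v}"
  proof (rule bij_betw_imageI)
    show "(@) u ` subtree x u = {v \<in> x. prefix u v}"
      using harris_tree_nodes[OF assms]
      by (force simp: subtree_def prefix_def nodes_def image_iff)
  qed (auto simp: inj_on_def)
  then show ?thesis by (simp add: weight_def bij_betw_same_card)
qed

lemma weight_Nil: "weight x [] = card x"
  by (simp add: weight_def)

lemma weight_eq_0_iff:
  assumes "harris_tree x" shows "weight x u = 0 \<longleftrightarrow> u \<notin> x"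
  using harris_tree_finite[OF assms] harris_tree_prefix[OF assms]
  by (auto simp: weight_def)

lemma weight_mono: "finite x \<Longrightarrow> prefix u w \<Longrightarrow> weight x w \<le> weight x u"
  unfolding weight_def by (rule card_mono) (auto intro: prefix_order.trans)

lemma weight_le_card: "finite x \<Longrightarrow> weight x u \<le> card x"
  unfolding weight_def by (rule card_mono) auto

lemma weight_grow:
  assumes "harris_tree x"
  shows "weight (grow x v) u = weight x u + (if prefix u (new_node x v) then 1 else 0)"
proof -
  have "{w \<in> grow x v. prefix u w} =
     (if prefix u (new_node x v) then insert (new_node x v) {w \<in> x. prefix u w} else {w \<in> x. prefix u w})"
    by (auto simp: grow_def)
  then show ?thesis
    using harris_tree_finite[OF assms] new_node_notin[OF assms, of v] by (simp add: weight_def)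
qed

lemma prefix_new_node: "prefix u (new_node x v) \<longleftrightarrow> prefix u v \<or> u = new_node x v"
  by (auto simp: new_node_def)

lemma weight_new_node: "harris_tree x \<Longrightarrow> weight x (new_node x v) = 0"
  by (simp add: weight_eq_0_iff new_node_notin)

lemma weight_snoc_ge_card: "harris_tree x \<Longrightarrow> card x \<le> i \<Longrightarrow> weight x (u @ [i]) = 0"
  using snoc_mem_less_card[of x u i] by (auto simp: weight_eq_0_iff)

text \<open>
  Children beyond the size of the tree have weight 0. Sums over the children of a node may thus use any
  common upper limit, so that a tree can be compared with its extensions.
\<close>

lemma sum_children_extend:
  fixes f :: "nat \<Rightarrow> nat \<Rightarrow> real"
  assumes "harris_tree x" "card x \<le> b" "\<And>i. f i 0 = 0"
  shows "(\<Sum>i=a..card x. f i (weight x (u @ [i]))) = (\<Sum>i=a..b. f i (weight x (u @ [i])))"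
  by (rule sum.mono_neutral_left) (use assms weight_snoc_ge_card[OF assms(1)] in auto)

lemma sum_prefix_weight:
  "finite x \<Longrightarrow> (\<Sum>v\<in>x. if prefix u v then c else 0) = real (weight x u) * c"
  by (simp add: weight_def sum.If_cases Int_def)

text \<open>
  A node strictly below \<open>u\<close> lies below exactly one child of \<open>u\<close>.
\<close>

lemma sum_children_weight:
  assumes "harris_tree x"
  shows "(\<Sum>i=1..card x. real (weight x (u @ [i]))) = real (weight x u) - (if u \<in> x then 1 else 0)"
proof -
  note fin = harris_tree_finite[OF assms]
  have one: "(\<Sum>i=1..card x. if prefix (u @ [i]) v then 1 else (0::real))
        = (if prefix u v \<and> v \<noteq> u then 1 else 0)" if v: "v \<in> x" for v
  proof (cases "prefix u v \<and> v \<noteq> u")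
    case True
    then obtain i r where vi: "v = u @ i # r"
      by (metis append_Nil2 list.exhaust prefix_def)
    have "u @ [i] \<in> x"
      by (rule harris_tree_prefix[OF assms v]) (simp add: vi)
    then have i: "i \<in> {1..card x}"
      using snoc_mem_less_card[OF assms, of u i] snoc_mem_iff[OF assms, of u i]
      by auto
    have "(\<Sum>j=1..card x. if prefix (u @ [j]) v then 1 else (0::real)) = (\<Sum>j=1..card x. if j = i then 1 else 0)"
      by (rule sum.cong) (auto simp: vi)
    then show ?thesis using True i by simp
  next
    case False
    then have "\<not> prefix (u @ [i]) v" for i
      by (metis append_prefixD prefix_order.eq_iff prefix_snoc not_Cons_self2 same_append_eq append_self_conv)
    then show ?thesis using False by simp
  qed
  have "(\<Sum>i=1..card x. real (weight x (u @ [i]))) = (\<Sum>i=1..card x. \<Sum>v\<in>x. if prefix (u @ [i]) v then 1 else 0)"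
    by (simp add: sum_prefix_weight[OF fin])
  also have "\<dots> = (\<Sum>v\<in>x. if prefix u v \<and> v \<noteq> u then 1 else 0)"
    by (subst sum.swap) (intro sum.cong refl one)
  also have "\<dots> = (\<Sum>v\<in>x. (if prefix u v then 1 else 0) - (if v = u then 1 else 0))"
    by (rule sum.cong) auto
  also have "\<dots> = real (weight x u) - (if u \<in> x then 1 else 0)"
    using sum_prefix_weight[OF fin, of u 1] fin by (simp add: sum_subtractf)
  finally show ?thesis .
qed

section \<open>Tolls and the residual path length\<close>

definition nharm :: "nat \<Rightarrow> real" where
  "nharm m = real m * harm m"

lemma nharm_0 [simp]: "nharm 0 = 0"
  by (simp add: nharm_def)

lemma nharm_Suc: "nharm (Suc m) = nharm m + harm m + 1"
  by (simp add: nharm_def harm_Suc field_simps)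

text \<open>
  The contribution of the branching at \<open>u\<close> to the centred path length. Divided by the size of the tree it is
  the finite counterpart of \<open>X\<^sub>\<infinity>(A\<^sub>u) C(\<rho>(X\<^sub>\<infinity>, u))\<close>.
\<close>

definition toll :: "nat list set \<Rightarrow> nat list \<Rightarrow> real" where
  "toll x u = real (weight x u) - nharm (weight x u) + (\<Sum>i=1..card x. nharm (weight x (u @ [i])))"

lemma toll_outside: "harris_tree x \<Longrightarrow> u \<notin> x \<Longrightarrow> toll x u = 0"
  using weight_eq_0_iff[of x u] weight_eq_0_iff[of x "u @ [i]" for i] harris_tree_prefix[of x "u @ [i]" u for i]
  by (auto simp: toll_def intro!: sum.neutral) (metis nharm_0 prefixI)

text \<open>
  Only the next node on the ancestral line of \<open>w\<close> survives in a sum over the children of \<open>u\<close>.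
\<close>

lemma sum_prefix_snoc:
  fixes f :: "nat list \<Rightarrow> real"
  assumes "prefix u w" "w \<noteq> u" "w ! length u \<in> {1..b}"
  shows "(\<Sum>i=1..b. if prefix (u @ [i]) w then f (u @ [i]) else 0) = f (take (Suc (length u)) w)"
proof -
  obtain i r where w: "w = u @ i # r"
    using assms by (metis append_Nil2 list.exhaust prefix_def)
  have "(\<Sum>j=1..b. if prefix (u @ [j]) w then f (u @ [j]) else 0) = (\<Sum>j=1..b. if j = i then f (u @ [j]) else 0)"
    by (rule sum.cong) (auto simp: w)
  also have "\<dots> = f (u @ [i])" using assms(3) by (simp add: w)
  finally show ?thesis by (simp add: w)
qed

lemma not_prefix_snoc: "\<not> prefix u w \<or> w = u \<Longrightarrow> \<not> prefix (u @ [i]) w"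
  by (auto simp: prefix_def)

lemma mem_nth_le_card:
  assumes "harris_tree x" "w \<in> x" "l < length w" shows "w ! l \<in> {1..card x}"
proof -
  have "take l w @ [w ! l] \<in> x"
    using assms by (metis take_Suc_conv_app_nth harris_tree_prefix take_is_prefix)
  then show ?thesis using snoc_mem_iff[OF assms(1)] num_children_less_card[OF assms(1), of "take l w"]
    by auto
qed

text \<open>
  Since \<open>K (m + 1) - K m = H m + 1\<close>, a new node changes the toll at \<open>u\<close> only if \<open>u\<close> is an ancestor of it. The new
  node itself has weight 0 and \<open>H 0 = 0\<close>, so only prefixes of the parent \<open>v\<close> occur.
\<close>

lemma toll_grow:
  assumes x: "harris_tree x" and v: "v \<in> x"
  shows "toll (grow x v) u = toll x u + (if prefix u v then 1 - harm (weight x u) else 0)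
     + (\<Sum>i=1..card x. if prefix (u @ [i]) v then harm (weight x (u @ [i])) else 0)"
proof -
  let ?w = "new_node x v" and ?b = "Suc (card x)"
  note hg = harris_tree_grow[OF x v]
  have nh: "nharm (weight (grow x v) a) = nharm (weight x a) +
      ((if prefix a v then harm (weight x a) else 0) + (if prefix a ?w then 1 else 0))" for a
    using weight_new_node[OF x, of v]
    by (auto simp: weight_grow[OF x] nharm_Suc prefix_new_node harm_expand)
  have w_card: "?w ! length u \<in> {1..?b}" if "prefix u ?w" "?w \<noteq> u"
  proof -
    have "length u < length ?w" using that by (intro prefix_length_less) (auto simp: strict_prefix_def)
    then show ?thesis
      using mem_nth_le_card[OF hg, of ?w "length u"] card_grow[OF x, of v] by (simp add: grow_def)
  qed
  have one: "(\<Sum>i=1..?b. if prefix (u @ [i]) ?w then 1 else 0) = (if prefix u v then 1 else (0::real))"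
  proof (cases "prefix u v")
    case True
    then have "prefix u ?w" "?w \<noteq> u" using v new_node_notin[OF x, of v] harris_tree_prefix[OF x v]
      by (auto simp: prefix_new_node)
    then show ?thesis using sum_prefix_snoc[of u ?w ?b "\<lambda>_. 1"] w_card True by simp
  next
    case False
    then show ?thesis using not_prefix_snoc[of u ?w] by (auto simp: prefix_new_node intro!: sum.neutral)
  qed
  have "(\<Sum>i=1..?b. nharm (weight (grow x v) (u @ [i]))) = (\<Sum>i=1..?b. nharm (weight x (u @ [i])))
     + (\<Sum>i=1..?b. if prefix (u @ [i]) v then harm (weight x (u @ [i])) else 0)
     + (\<Sum>i=1..?b. if prefix (u @ [i]) ?w then 1 else 0)"
    by (simp only: nh sum.distrib add.assoc)
  also have "(\<Sum>i=1..?b. nharm (weight x (u @ [i]))) = (\<Sum>i=1..card x. nharm (weight x (u @ [i])))"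
    using weight_snoc_ge_card[OF x, of ?b u] by simp
  also have "(\<Sum>i=1..?b. if prefix (u @ [i]) v then harm (weight x (u @ [i])) else 0)
      = (\<Sum>i=1..card x. if prefix (u @ [i]) v then harm (weight x (u @ [i])) else (0::real))"
    using weight_snoc_ge_card[OF x, of ?b u] by (simp add: harm_expand)
  finally have "(\<Sum>i=1..?b. nharm (weight (grow x v) (u @ [i]))) = (\<Sum>i=1..card x. nharm (weight x (u @ [i])))
     + (\<Sum>i=1..card x. if prefix (u @ [i]) v then harm (weight x (u @ [i])) else 0)
     + (if prefix u v then 1 else 0)" unfolding one .
  moreover have "real (weight (grow x v) u) = weight x u + (if prefix u ?w then 1 else 0)"
    by (simp add: weight_grow[OF x])
  ultimately show ?thesis unfolding toll_def card_grow[OF x] nh by auto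
qed

text \<open>
  For such functions \<open>f (X n) / n\<close> is a martingale: the mean of \<open>f\<close> over the \<open>n\<close> extensions of a tree of
  size \<open>n\<close> is \<open>(1 + 1 / n) * f x\<close>.
\<close>

definition harmonic :: "(nat list set \<Rightarrow> real) \<Rightarrow> bool" where
  "harmonic f \<longleftrightarrow> (\<forall>x. harris_tree x \<longrightarrow> (\<Sum>v\<in>x. f (grow x v) - f x) = f x)"

lemma harmonic_toll: "harmonic (\<lambda>x. toll x u)"
  unfolding harmonic_def
proof (intro allI impI)
  fix x assume x: "harris_tree x"
  note fin = harris_tree_finite[OF x]
  have "(\<Sum>v\<in>x. toll (grow x v) u - toll x u) = (\<Sum>v\<in>x. (if prefix u v then 1 - harm (weight x u) else 0)
     + (\<Sum>i=1..card x. if prefix (u @ [i]) v then harm (weight x (u @ [i])) else 0))"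
    by (intro sum.cong) (auto simp: toll_grow[OF x])
  also have "\<dots> = (\<Sum>v\<in>x. (if prefix u v then 1 - harm (weight x u) else 0))
     + (\<Sum>i=1..card x. \<Sum>v\<in>x. if prefix (u @ [i]) v then harm (weight x (u @ [i])) else 0)"
    by (simp only: sum.distrib sum.swap[of _ _ "{1..card x}"])
  also have "\<dots> = toll x u"
    by (simp only: sum_prefix_weight[OF fin]) (simp add: toll_def nharm_def algebra_simps)
  finally show "(\<Sum>v\<in>x. toll (grow x v) u - toll x u) = toll x u" .
qed

lemma harmonic_diff: "harmonic f \<Longrightarrow> harmonic g \<Longrightarrow> harmonic (\<lambda>x. f x - g x)"
  unfolding harmonic_def
proof (intro allI impI)
  fix x assume h: "\<forall>x. harris_tree x \<longrightarrow> (\<Sum>v\<in>x. f (grow x v) - f x) = f x"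
    "\<forall>x. harris_tree x \<longrightarrow> (\<Sum>v\<in>x. g (grow x v) - g x) = g x" and x: "harris_tree x"
  have "(\<Sum>v\<in>x. f (grow x v) - g (grow x v) - (f x - g x))
      = (\<Sum>v\<in>x. f (grow x v) - f x) - (\<Sum>v\<in>x. g (grow x v) - g x)"
    unfolding sum_subtractf[symmetric] by (rule sum.cong) auto
  then show "(\<Sum>v\<in>x. f (grow x v) - g (grow x v) - (f x - g x)) = f x - g x"
    using h x by simp
qed

lemma harmonic_sum: "(\<And>u. u \<in> S \<Longrightarrow> harmonic (f u)) \<Longrightarrow> harmonic (\<lambda>x. \<Sum>u\<in>S. f u x)"
  unfolding harmonic_def
proof (intro allI impI)
  fix x assume h: "\<And>u. u \<in> S \<Longrightarrow> \<forall>x. harris_tree x \<longrightarrow> (\<Sum>v\<in>x. f u (grow x v) - f u x) = f u x"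
    and x: "harris_tree x"
  have "(\<Sum>v\<in>x. (\<Sum>u\<in>S. f u (grow x v)) - (\<Sum>u\<in>S. f u x)) = (\<Sum>u\<in>S. \<Sum>v\<in>x. f u (grow x v) - f u x)"
    unfolding sum_subtractf[symmetric] by (rule sum.swap)
  also have "\<dots> = (\<Sum>u\<in>S. f u x)" using h x by simp
  finally show "(\<Sum>v\<in>x. (\<Sum>u\<in>S. f u (grow x v)) - (\<Sum>u\<in>S. f u x)) = (\<Sum>u\<in>S. f u x)" .
qed

text \<open>
  This is \<open>n\<close> times the normalized path length of the theorem.
\<close>

definition centred_TPL :: "nat list set \<Rightarrow> real" where
  "centred_TPL x = real (TPL x) + real (card x) - nharm (card x)"

lemma sum_grow:
  fixes f :: "nat list \<Rightarrow> 'b :: comm_monoid_add"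
  shows "harris_tree x \<Longrightarrow> (\<Sum>u\<in>grow x v. f u) = f (new_node x v) + (\<Sum>u\<in>x. f u)"
  by (simp add: grow_def harris_tree_finite new_node_notin)

lemma TPL_grow: "harris_tree x \<Longrightarrow> TPL (grow x v) = TPL x + Suc (length v)"
  by (simp add: TPL_def sum_grow) (simp add: new_node_def)

lemma centred_TPL_grow: "harris_tree x \<Longrightarrow> centred_TPL (grow x v) = centred_TPL x + (real (length v) + 1 - harm (card x))"
  by (simp add: centred_TPL_def TPL_grow card_grow nharm_Suc)

lemma harmonic_centred_TPL: "harmonic centred_TPL"
  unfolding harmonic_def
proof (intro allI impI)
  fix x assume x: "harris_tree x"
  have "(\<Sum>v\<in>x. centred_TPL (grow x v) - centred_TPL x) = (\<Sum>v\<in>x. real (length v) + 1 - harm (card x))"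
    by (simp add: centred_TPL_grow[OF x])
  also have "\<dots> = centred_TPL x"
    by (simp add: sum.distrib sum_subtractf TPL_def centred_TPL_def nharm_def)
  finally show "(\<Sum>v\<in>x. centred_TPL (grow x v) - centred_TPL x) = centred_TPL x" .
qed

definition small_nodes :: "nat \<Rightarrow> nat list set" where
  "small_nodes k = {u \<in> nodes. sum_list u < k}"

lemma finite_small_nodes: "finite (small_nodes k)"
  by (rule finite_subset[OF _ finite_nodes_sum_le[of k]]) (auto simp: small_nodes_def)

text \<open>
  For \<open>k = 0\<close> no toll is subtracted, so that the centred path length itself is a residual.
\<close>

definition residual :: "nat \<Rightarrow> nat list set \<Rightarrow> real" where
  "residual k x = centred_TPL x - (\<Sum>u\<in>small_nodes k. toll x u)"

lemma harmonic_residual: "harmonic (residual k)"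
  unfolding residual_def by (intro harmonic_diff harmonic_sum harmonic_centred_TPL harmonic_toll)

lemma sum_list_take_mono: "l \<le> m \<Longrightarrow> sum_list (take l v) \<le> sum_list (take m (v :: nat list))"
  by (metis append_take_drop_id le_add1 min.absorb1 sum_list_append take_take)

text \<open>
  The nodes with \<open>sum_list u < k\<close> among the ancestors of the new node are its prefixes of length less than
  some \<open>j\<close>. With \<open>\<eta> l\<close> the harmonic number of the weight of the prefix of length \<open>l\<close>, the toll at this prefix
  changes by \<open>1 - \<eta> l + \<eta> (l + 1)\<close>. The sum telescopes to \<open>j + \<eta> j - \<eta> 0\<close>, and \<open>\<eta> 0\<close>
  cancels against the harmonic number in the increment of the centred path length.
\<close>

lemma residual_grow:
  assumes x: "harris_tree x" and v: "v \<in> x"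
  obtains j e where "j \<le> Suc (length v)" "0 \<le> e" "e \<le> harm (card x)"
    "card x \<le> k \<Longrightarrow> j = Suc (length v) \<and> e = 0"
    "residual k (grow x v) - residual k x = real (Suc (length v) - j) - e"
proof -
  define P where "P l \<longleftrightarrow> l \<le> length v \<and> sum_list (take l v) < k" for l
  define j where "j = (LEAST l. \<not> P l)"
  have nP: "\<not> P (Suc (length v))" by (simp add: P_def)
  have jl: "j \<le> Suc (length v)" unfolding j_def by (rule Least_le[of _ "Suc (length v)"]) (rule nP)
  have Pj: "P l \<longleftrightarrow> l < j" for l
  proof
    assume "l < j" then show "P l" unfolding j_def using not_less_Least by blast
  next
    assume l: "P l"
    have "\<not> P j" unfolding j_def using nP by (rule LeastI)
    show "l < j"
    proof (rule ccontr)
      assume "\<not> l < j"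
      then have "P j" using l sum_list_take_mono[of j l v] by (auto simp: P_def)
      then show False using \<open>\<not> P j\<close> by simp
    qed
  qed
  \<comment> \<open>beyond the parent the next prefix is the new node, which has no weight yet\<close>
  define eta :: "nat \<Rightarrow> real" where
    "eta l = (if l \<le> length v then harm (weight x (take l v)) else 0)" for l
  let ?D = "\<lambda>u. (if prefix u v then 1 - harm (weight x u) else 0)
     + (\<Sum>i=1..card x. if prefix (u @ [i]) v then harm (weight x (u @ [i])) else 0)"
  have vn: "v \<in> nodes" using harris_tree_nodes[OF x v] .
  have img: "{u \<in> small_nodes k. prefix u v} = (\<lambda>l. take l v) ` {..<j}"
  proof (intro equalityI subsetI)
    fix u assume u: "u \<in> {u \<in> small_nodes k. prefix u v}"
    then have "u = take (length u) v" "length u \<le> length v"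
      by (auto simp: prefix_def)
    then have "P (length u)" using u by (auto simp: P_def small_nodes_def)
    then show "u \<in> (\<lambda>l. take l v) ` {..<j}" using \<open>u = take (length u) v\<close> Pj by auto
  next
    fix u assume "u \<in> (\<lambda>l. take l v) ` {..<j}"
    then obtain l where l: "u = take l v" "P l" using Pj by auto
    then show "u \<in> {u \<in> small_nodes k. prefix u v}"
      using vn by (auto simp: small_nodes_def P_def nodes_def take_is_prefix dest: in_set_takeD)
  qed
  have inj: "inj_on (\<lambda>l. take l v) {..<j}"
  proof (rule inj_onI)
    fix a b assume ab: "a \<in> {..<j}" "b \<in> {..<j}" "take a v = take b v"
    then have "length (take a v) = length (take b v)" by simp
    moreover have "a \<le> length v" "b \<le> length v" using ab jl by auto
    ultimately show "a = b" by simp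
  qed
  have D: "?D (take l v) = 1 - eta l + eta (Suc l)" if "l < j" for l
  proof -
    have ll: "l \<le> length v" using that jl by simp
    have "(\<Sum>i=1..card x. if prefix (take l v @ [i]) v then harm (weight x (take l v @ [i])) else 0) = eta (Suc l)"
    proof (cases "l < length v")
      case True
      have ne: "v \<noteq> take l v" using True by (metis length_take less_irrefl min.absorb4)
      have ll: "length (take l v) = l" using True by simp
      show ?thesis
        using sum_prefix_snoc[OF take_is_prefix ne, of "card x" "\<lambda>a. harm (weight x a)"]
          mem_nth_le_card[OF x v True] True unfolding ll by (simp add: eta_def)
    next
      case False
      then show ?thesis using not_prefix_snoc[of v v] ll by (simp add: eta_def)
    qed
    then show ?thesis using ll by (simp add: take_is_prefix eta_def)
  qed
  have "(\<Sum>u\<in>small_nodes k. toll (grow x v) u) - (\<Sum>u\<in>small_nodes k. toll x u) = (\<Sum>u\<in>small_nodes k. ?D u)"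
    by (simp add: toll_grow[OF x v] sum_subtractf[symmetric])
  also have "\<dots> = (\<Sum>u\<in>{u \<in> small_nodes k. prefix u v}. ?D u)"
    by (rule sum.mono_neutral_right) (auto simp: finite_small_nodes not_prefix_snoc intro!: sum.neutral)
  also have "\<dots> = (\<Sum>l<j. ?D (take l v))"
    unfolding img by (rule sum.reindex[OF inj, unfolded o_def])
  also have "\<dots> = (\<Sum>l<j. 1 + (eta (Suc l) - eta l))"
    by (rule sum.cong) (use D in auto)
  also have "\<dots> = real j + (eta j - eta 0)"
    by (simp only: sum.distrib sum_lessThan_telescope) simp
  also have "eta 0 = harm (card x)" by (simp add: eta_def weight_Nil)
  finally have *: "residual k (grow x v) - residual k x = real (Suc (length v) - j) - eta j"
    using jl by (simp add: residual_def centred_TPL_grow[OF x] of_nat_diff)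
  have e0: "0 \<le> eta j" by (simp add: eta_def harm_nonneg)
  have e1: "eta j \<le> harm (card x)"
    using weight_le_card[OF harris_tree_finite[OF x]]
    by (simp add: eta_def harm_nonneg harm_mono)
  have "j = Suc (length v) \<and> eta j = 0" if "card x \<le> k"
  proof -
    have "P (length v)" using sum_list_less_card[OF x v] that by (simp add: P_def)
    then have "j = Suc (length v)" using Pj jl by (simp add: le_antisym Suc_leI)
    then show ?thesis by (simp add: eta_def)
  qed
  then show ?thesis using that[OF jl e0 e1 _ *] by blast
qed

text \<open>
  The two terms of the increment have opposite signs, so the cross term can be dropped.
\<close>

lemma residual_grow_sq:
  assumes x: "harris_tree x" and v: "v \<in> x"
  shows "(residual k (grow x v) - residual k x)\<^sup>2 \<le> (if card x \<le> k then 0 else real ((length v + 1)\<^sup>2) + (harm (card x))\<^sup>2)"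
proof -
  obtain j e where je: "j \<le> Suc (length v)" "0 \<le> e" "e \<le> harm (card x)"
    "card x \<le> k \<Longrightarrow> j = Suc (length v) \<and> e = 0"
    "residual k (grow x v) - residual k x = real (Suc (length v) - j) - e"
    using residual_grow[OF x v] by blast
  let ?a = "real (Suc (length v) - j)"
  have "(?a - e)\<^sup>2 \<le> ?a\<^sup>2 + e\<^sup>2" using je(2) by (simp add: power2_diff)
  also have "?a\<^sup>2 \<le> (real (length v + 1))\<^sup>2" by (rule power_mono) auto
  also have "e\<^sup>2 \<le> (harm (card x))\<^sup>2" using je by (intro power_mono) auto
  finally show ?thesis using je(4,5) by auto
qed

lemma residual_root: "residual k {[]} = 0"
proof -
  have h: "harris_tree {[]}" by (auto simp: harris_tree_def nodes_def)
  have "toll {[]} u = 0" for u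
  proof (cases "u = []")
    case True
    then show ?thesis using weight_snoc_ge_card[OF h, of 1 "[]"]
      by (simp add: toll_def weight_Nil nharm_def harm_expand)
  next
    case False
    then show ?thesis using toll_outside[OF h] by simp
  qed
  then show ?thesis by (simp add: residual_def centred_TPL_def nharm_def TPL_def harm_expand)
qed

lemma harmonic_step:
  assumes "harmonic f" "x \<in> harris_trees n" "1 \<le> n"
  shows "(\<Sum>v\<in>x. f (grow x v) / real (Suc n)) / real n = f x / real n"
proof -
  have x: "harris_tree x" "card x = n" using assms by (auto simp: harris_trees_iff)
  have "(\<Sum>v\<in>x. f (grow x v)) = f x + real n * f x"
    using assms(1) x by (simp add: harmonic_def sum_subtractf algebra_simps)
  then have "(\<Sum>v\<in>x. f (grow x v)) = real (Suc n) * f x" by (simp add: algebra_simps)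
  then show ?thesis by (simp only: sum_divide_distrib[symmetric]) simp
qed

text \<open>
  The increments of \<open>f\<close> have mean \<open>f x / n\<close>. Hence the deviations of \<open>f / n\<close> from its old value have mean
  zero, and the sum of their squares is at most that of the uncentred increments.
\<close>

lemma harmonic_step_sq:
  assumes "harmonic f" "x \<in> harris_trees n" "1 \<le> n"
  shows "(\<Sum>v\<in>x. (f (grow x v) / real (Suc n) - c)\<^sup>2) / real n
    \<le> (f x / real n - c)\<^sup>2 + (\<Sum>v\<in>x. (f (grow x v) - f x)\<^sup>2) / real n / (real (Suc n))\<^sup>2"
proof -
  have x: "harris_tree x" "card x = n" using assms by (auto simp: harris_trees_iff)
  define a where "a = f x / real n"
  define d where "d v = f (grow x v) - f x" for v
  have n: "real n > 0" using assms by simp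
  have sd: "(\<Sum>v\<in>x. d v) = real n * a" using assms(1) x n by (simp add: harmonic_def d_def a_def)
  have eq: "f (grow x v) / real (Suc n) - c = (a - c) + (d v - a) / real (Suc n)" for v
  proof -
    have "f (grow x v) = real n * a + d v" using n by (simp add: d_def a_def)
    then show ?thesis using n by (simp add: field_simps)
  qed
  have "(\<Sum>v\<in>x. (f (grow x v) / real (Suc n) - c)\<^sup>2)
     = (\<Sum>v\<in>x. (a - c)\<^sup>2 + (2 * (a - c) / real (Suc n) * (d v - a) + (1 / (real (Suc n))\<^sup>2) * ((d v)\<^sup>2 - 2 * a * d v + a\<^sup>2)))"
    unfolding eq by (rule sum.cong[OF refl]) (simp add: power2_eq_square divide_inverse algebra_simps del: of_nat_Suc)
  also have "\<dots> = real n * (a - c)\<^sup>2 + (1 / (real (Suc n))\<^sup>2) * ((\<Sum>v\<in>x. (d v)\<^sup>2) - real n * a\<^sup>2)"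
    by (simp only: sum.distrib sum_distrib_left[symmetric] sum_subtractf sd sum_constant x(2))
       (simp add: power2_eq_square algebra_simps)
  also have "\<dots> \<le> real n * (a - c)\<^sup>2 + (1 / (real (Suc n))\<^sup>2) * (\<Sum>v\<in>x. (d v)\<^sup>2)"
    by (intro add_left_mono mult_left_mono) auto
  finally have "(\<Sum>v\<in>x. (f (grow x v) / real (Suc n) - c)\<^sup>2) / real n \<le>
      (real n * (a - c)\<^sup>2 + (1 / (real (Suc n))\<^sup>2) * (\<Sum>v\<in>x. (d v)\<^sup>2)) / real n"
    using n by (intro divide_right_mono) auto
  also have "\<dots> = (a - c)\<^sup>2 + (\<Sum>v\<in>x. (d v)\<^sup>2) / real n / (real (Suc n))\<^sup>2"
    using n by (simp add: field_simps)
  finally show ?thesis by (simp add: a_def d_def)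
qed

section \<open>The one-step law of the chain\<close>

lemma (in prob_space) finite_range_expectation:
  fixes g :: "'b \<Rightarrow> real"
  assumes A: "finite A" "\<And>\<omega>. \<omega> \<in> space M \<Longrightarrow> Z \<omega> \<in> A"
    "\<And>a. a \<in> A \<Longrightarrow> {\<omega> \<in> space M. Z \<omega> = a} \<in> events"
  shows "integrable M (\<lambda>\<omega>. g (Z \<omega>))"
    and "expectation (\<lambda>\<omega>. g (Z \<omega>)) = (\<Sum>a\<in>A. prob {\<omega> \<in> space M. Z \<omega> = a} * g a)"
proof -
  let ?E = "\<lambda>a. {\<omega> \<in> space M. Z \<omega> = a}"
  have eq: "g (Z \<omega>) = (\<Sum>a\<in>A. indicator (?E a) \<omega> * g a)" if "\<omega> \<in> space M" for \<omega>
  proof -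
    have "(\<Sum>a\<in>A. indicator (?E a) \<omega> * g a) = (\<Sum>a\<in>A. if a = Z \<omega> then g a else 0)"
      using that by (intro sum.cong) (auto simp: indicator_def)
    then show ?thesis using A that by simp
  qed
  have int: "integrable M (\<lambda>\<omega>. indicator (?E a) \<omega> * g a)" if "a \<in> A" for a
    using A(3)[OF that] by (intro integrable_mult_left) (auto simp: emeasure_eq_measure)
  have "integrable M (\<lambda>\<omega>. \<Sum>a\<in>A. indicator (?E a) \<omega> * g a)"
    by (rule Bochner_Integration.integrable_sum) (rule int)
  then show "integrable M (\<lambda>\<omega>. g (Z \<omega>))"
    by (subst Bochner_Integration.integrable_cong[OF refl eq])
  have "expectation (\<lambda>\<omega>. g (Z \<omega>)) = expectation (\<lambda>\<omega>. \<Sum>a\<in>A. indicator (?E a) \<omega> * g a)"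
    by (rule Bochner_Integration.integral_cong[OF refl eq])
  also have "\<dots> = (\<Sum>a\<in>A. expectation (\<lambda>\<omega>. indicator (?E a) \<omega> * g a))"
    by (rule Bochner_Integration.integral_sum) (rule int)
  also have "\<dots> = (\<Sum>a\<in>A. prob (?E a) * g a)"
  proof (intro sum.cong refl)
    fix a
    have "?E a \<inter> space M = ?E a" by auto
    then show "expectation (\<lambda>\<omega>. indicator (?E a) \<omega> * g a) = prob (?E a) * g a" by simp
  qed
  finally show "expectation (\<lambda>\<omega>. g (Z \<omega>)) = (\<Sum>a\<in>A. prob (?E a) * g a)" .
qed

locale harris_process = prob_space M for M :: "'w measure" +
  fixes X :: "nat \<Rightarrow> 'w \<Rightarrow> nat list set"
  assumes chain: "harris_chain M X"
begin

lemma X_measurable: "1 \<le> n \<Longrightarrow> X n \<in> M \<rightarrow>\<^sub>M count_space (harris_trees n)"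
  using chain by (simp add: harris_chain_def)

lemma X_mem: "1 \<le> n \<Longrightarrow> \<omega> \<in> space M \<Longrightarrow> X n \<omega> \<in> harris_trees n"
  using measurable_space[OF X_measurable] by simp

lemma X_tree: "1 \<le> n \<Longrightarrow> \<omega> \<in> space M \<Longrightarrow> harris_tree (X n \<omega>)"
  and X_card: "1 \<le> n \<Longrightarrow> \<omega> \<in> space M \<Longrightarrow> card (X n \<omega>) = n"
  using X_mem by (auto simp: harris_trees_iff)

lemma X_1: "\<omega> \<in> space M \<Longrightarrow> X 1 \<omega> = {[]}"
  using chain by (simp add: harris_chain_def)

lemma X_event: "1 \<le> n \<Longrightarrow> {\<omega> \<in> space M. X n \<omega> = x} \<in> events"
proof -
  assume n: "1 \<le> n"
  have "X n -` ({x} \<inter> harris_trees n) \<inter> space M \<in> events"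
    by (rule measurable_sets[OF X_measurable[OF n]]) auto
  also have "X n -` ({x} \<inter> harris_trees n) \<inter> space M = {\<omega> \<in> space M. X n \<omega> = x}"
    using X_mem[OF n] by auto
  finally show ?thesis .
qed

lemma measurable_X: "1 \<le> n \<Longrightarrow> (\<lambda>\<omega>. g (X n \<omega>)) \<in> borel_measurable M"
  by (rule measurable_compose[OF X_measurable]) auto

lemma history_event: "{\<omega> \<in> space M. \<forall>i\<in>{1..n}. X i \<omega> = h i} \<in> events"
  by (rule sets.sets_Collect_finite_All) (auto intro: X_event[simplified])

lemma hist_mem: "\<omega> \<in> space M \<Longrightarrow> restrict (\<lambda>i. X i \<omega>) {1..n} \<in> PiE {1..n} harris_trees"
  using X_mem by auto

lemma hist_eq_iff: "h \<in> PiE {1..n} harris_trees \<Longrightarrow>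
  restrict (\<lambda>i. X i \<omega>) {1..n} = h \<longleftrightarrow> (\<forall>i\<in>{1..n}. X i \<omega> = h i)"
  by (auto simp: fun_eq_iff PiE_def extensional_def)

lemma finite_hist: "finite (PiE {1..n} harris_trees)"
  by (intro finite_PiE) (auto simp: finite_harris_trees)

lemma hist_expectation:
  fixes G :: "(nat \<Rightarrow> nat list set) \<Rightarrow> real"
  shows "integrable M (\<lambda>\<omega>. G (restrict (\<lambda>i. X i \<omega>) {1..n}))"
    "expectation (\<lambda>\<omega>. G (restrict (\<lambda>i. X i \<omega>) {1..n}))
      = (\<Sum>h\<in>PiE {1..n} harris_trees. prob {\<omega> \<in> space M. \<forall>i\<in>{1..n}. X i \<omega> = h i} * G h)"
proof -
  have ev: "{\<omega> \<in> space M. restrict (\<lambda>i. X i \<omega>) {1..n} = h} = {\<omega> \<in> space M. \<forall>i\<in>{1..n}. X i \<omega> = h i}"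
    if "h \<in> PiE {1..n} harris_trees" for h using hist_eq_iff[OF that] by auto
  note * = finite_range_expectation[OF finite_hist[of n], of "\<lambda>\<omega>. restrict (\<lambda>i. X i \<omega>) {1..n}" G]
  show "integrable M (\<lambda>\<omega>. G (restrict (\<lambda>i. X i \<omega>) {1..n}))"
    by (rule *) (use hist_mem history_event ev in auto)
  show "expectation (\<lambda>\<omega>. G (restrict (\<lambda>i. X i \<omega>) {1..n}))
      = (\<Sum>h\<in>PiE {1..n} harris_trees. prob {\<omega> \<in> space M. \<forall>i\<in>{1..n}. X i \<omega> = h i} * G h)"
    by (subst *(2)) (use hist_mem history_event ev in \<open>auto intro!: sum.cong\<close>)
qed

lemma integrable_X: "1 \<le> n \<Longrightarrow> integrable M (\<lambda>\<omega>. g (X n \<omega>) :: real)"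
  using hist_expectation(1)[of "\<lambda>h. g (h n)" n] by simp

lemma integrable_X2: "1 \<le> m \<Longrightarrow> 1 \<le> n \<Longrightarrow> integrable M (\<lambda>\<omega>. g (X m \<omega>) (X n \<omega>) :: real)"
  using hist_expectation(1)[of "\<lambda>h. g (h m) (h n)" "max m n"] by simp

text \<open>
  Multiplying out the conditional probability covers the histories of probability zero, for which both sides
  vanish.
\<close>

lemma transition:
  assumes n: "1 \<le> n" and h: "h \<in> PiE {1..n} harris_trees" and y: "y \<in> harris_trees (Suc n)"
  shows "prob {\<omega> \<in> space M. (\<forall>i\<in>{1..n}. X i \<omega> = h i) \<and> X (Suc n) \<omega> = y}
    = prob {\<omega> \<in> space M. \<forall>i\<in>{1..n}. X i \<omega> = h i} * (if h n \<subseteq> y then 1 / real n else 0)"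
proof -
  let ?H = "{\<omega> \<in> space M. \<forall>i\<in>{1..n}. X i \<omega> = h i}"
  let ?J = "{\<omega> \<in> space M. (\<forall>i\<in>{1..n}. X i \<omega> = h i) \<and> X (Suc n) \<omega> = y}"
  define x where "x = h(Suc n := y)"
  have xm: "\<forall>i\<in>{1..n+1}. x i \<in> harris_trees i" using h y by (auto simp: x_def)
  have xh: "(\<forall>i\<in>{1..n}. X i \<omega> = x i) \<longleftrightarrow> (\<forall>i\<in>{1..n}. X i \<omega> = h i)" for \<omega>
    by (auto simp: x_def)
  have cp: "prob ?H > 0 \<Longrightarrow> \<P>(\<omega> in M. X (n + 1) \<omega> = x (n + 1) \<bar> \<forall>i\<in>{1..n}. X i \<omega> = x i)
          = (if x n \<subseteq> x (n + 1) then 1 / real n else 0)"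
    using chain n xm unfolding harris_chain_def xh[symmetric] by blast
  show ?thesis
  proof (cases "prob ?H > 0")
    case True
    have "\<P>(\<omega> in M. X (n + 1) \<omega> = x (n + 1) \<bar> \<forall>i\<in>{1..n}. X i \<omega> = x i) = prob ?J / prob ?H"
      unfolding cond_prob_def xh by (simp add: x_def conj_commute)
    moreover have "x n = h n" "x (n + 1) = y" by (auto simp: x_def)
    ultimately have "prob ?J / prob ?H = (if h n \<subseteq> y then 1 / real n else 0)"
      using cp[OF True] by simp
    moreover have "prob ?H \<noteq> 0" using True by simp
    ultimately have "prob ?J = (if h n \<subseteq> y then 1 / real n else 0) * prob ?H"
      using nonzero_divide_eq_eq[THEN iffD1] by blast
    then show ?thesis by (simp only: mult.commute)
  next
    case False
    then have H0: "prob ?H = 0" by (simp add: zero_less_measure_iff)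
    have "prob ?J \<le> prob ?H" by (rule finite_measure_mono[OF _ history_event]) auto
    then have "prob ?J = 0" using H0 measure_nonneg[of M ?J] by linarith
    then show ?thesis using H0 by (simp only: mult_zero_left)
  qed
qed

text \<open>
  The Markov property in the form that is used below. The earlier state \<open>X m\<close> is kept as a
  further argument, since orthogonality of martingale increments needs conditioning on the past.
\<close>

lemma step_expectation:
  fixes F :: "nat list set \<Rightarrow> nat list set \<Rightarrow> nat list set \<Rightarrow> real"
  assumes m: "1 \<le> m" "m \<le> n"
  shows "expectation (\<lambda>\<omega>. F (X m \<omega>) (X n \<omega>) (X (Suc n) \<omega>))
    = expectation (\<lambda>\<omega>. (\<Sum>v\<in>X n \<omega>. F (X m \<omega>) (X n \<omega>) (grow (X n \<omega>) v)) / real n)"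
proof -
  let ?P = "PiE {1..n} harris_trees"
  let ?p = "\<lambda>h. prob {\<omega> \<in> space M. \<forall>i\<in>{1..n}. X i \<omega> = h i}"
  have n: "1 \<le> n" using m by simp
  define Z where "Z \<omega> = (restrict (\<lambda>i. X i \<omega>) {1..n}, X (Suc n) \<omega>)" for \<omega>
  define G where "G = (\<lambda>(h, y). F (h m) (h n) y)"
  have ev: "{\<omega> \<in> space M. Z \<omega> = a} = {\<omega> \<in> space M. (\<forall>i\<in>{1..n}. X i \<omega> = fst a i) \<and> X (Suc n) \<omega> = snd a}"
    if "a \<in> ?P \<times> harris_trees (Suc n)" for a
    using that hist_eq_iff[of "fst a" n] by (auto simp: Z_def prod_eq_iff)
  have evs: "{\<omega> \<in> space M. (\<forall>i\<in>{1..n}. X i \<omega> = h i) \<and> X (Suc n) \<omega> = y} \<in> events" for h y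
    by (intro sets.sets_Collect_conj history_event X_event) simp
  have "expectation (\<lambda>\<omega>. F (X m \<omega>) (X n \<omega>) (X (Suc n) \<omega>)) = expectation (\<lambda>\<omega>. G (Z \<omega>))"
    using m by (simp add: G_def Z_def)
  also have "\<dots> = (\<Sum>a\<in>?P \<times> harris_trees (Suc n). prob {\<omega> \<in> space M. Z \<omega> = a} * G a)"
  proof (rule finite_range_expectation(2))
    show "finite (?P \<times> harris_trees (Suc n))" by (intro finite_cartesian_product finite_hist finite_harris_trees)
    show "Z \<omega> \<in> ?P \<times> harris_trees (Suc n)" if "\<omega> \<in> space M" for \<omega>
      using hist_mem[OF that] X_mem[OF _ that] unfolding Z_def by simp
    show "{\<omega> \<in> space M. Z \<omega> = a} \<in> events" if "a \<in> ?P \<times> harris_trees (Suc n)" for a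
      unfolding ev[OF that] by (rule evs)
  qed
  also have "\<dots> = (\<Sum>a\<in>?P \<times> harris_trees (Suc n).
      ?p (fst a) * (if fst a n \<subseteq> snd a then F (fst a m) (fst a n) (snd a) / real n else 0))"
  proof (intro sum.cong refl)
    fix a assume a: "a \<in> ?P \<times> harris_trees (Suc n)"
    then have "fst a \<in> ?P" "snd a \<in> harris_trees (Suc n)" by auto
    then show "prob {\<omega> \<in> space M. Z \<omega> = a} * G a
      = ?p (fst a) * (if fst a n \<subseteq> snd a then F (fst a m) (fst a n) (snd a) / real n else 0)"
      unfolding ev[OF a] transition[OF n \<open>fst a \<in> ?P\<close> \<open>snd a \<in> harris_trees (Suc n)\<close>]
      by (simp add: G_def case_prod_beta)
  qed
  also have "\<dots> = (\<Sum>h\<in>?P. ?p h * (\<Sum>y\<in>harris_trees (Suc n). if h n \<subseteq> y then F (h m) (h n) y / real n else 0))"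
    by (simp add: sum.cartesian_product' sum_distrib_left cong: if_cong)
  also have "\<dots> = (\<Sum>h\<in>?P. ?p h * ((\<Sum>v\<in>h n. F (h m) (h n) (grow (h n) v)) / real n))"
  proof (intro sum.cong refl arg_cong2[where f = "(*)"])
    fix h assume "h \<in> ?P"
    then have hn: "h n \<in> harris_trees n" using n by auto
    have "(\<Sum>y\<in>harris_trees (Suc n). if h n \<subseteq> y then F (h m) (h n) y / real n else 0)
      = (\<Sum>y\<in>{y \<in> harris_trees (Suc n). h n \<subseteq> y}. F (h m) (h n) y / real n)"
      by (rule sum.inter_filter[symmetric]) (rule finite_harris_trees)
    also have "\<dots> = (\<Sum>v\<in>h n. F (h m) (h n) (grow (h n) v) / real n)"
      by (rule sum.reindex_bij_betw[OF bij_betw_grow[OF hn], symmetric])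
    finally show "(\<Sum>y\<in>harris_trees (Suc n). if h n \<subseteq> y then F (h m) (h n) y / real n else 0)
      = (\<Sum>v\<in>h n. F (h m) (h n) (grow (h n) v)) / real n" by (simp add: sum_divide_distrib)
  qed
  also have "\<dots> = expectation (\<lambda>\<omega>. (\<Sum>v\<in>X n \<omega>. F (X m \<omega>) (X n \<omega>) (grow (X n \<omega>) v)) / real n)"
    using hist_expectation(2)[of "\<lambda>h. (\<Sum>v\<in>h n. F (h m) (h n) (grow (h n) v)) / real n" n] m by simp
  finally show ?thesis .
qed

lemma step_expectation1:
  fixes F :: "nat list set \<Rightarrow> nat list set \<Rightarrow> real"
  assumes "1 \<le> n"
  shows "expectation (\<lambda>\<omega>. F (X n \<omega>) (X (Suc n) \<omega>))
    = expectation (\<lambda>\<omega>. (\<Sum>v\<in>X n \<omega>. F (X n \<omega>) (grow (X n \<omega>) v)) / real n)"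
  using step_expectation[of n n "\<lambda>_. F"] assms by simp

lemma X_mono_AE: "AE \<omega> in M. \<forall>n\<ge>1. X n \<omega> \<subseteq> X (Suc n) \<omega>"
  unfolding AE_all_countable
proof
  fix n
  show "AE \<omega> in M. 1 \<le> n \<longrightarrow> X n \<omega> \<subseteq> X (Suc n) \<omega>"
  proof (cases "1 \<le> n")
    case n: True
    define F :: "nat list set \<Rightarrow> nat list set \<Rightarrow> real" where "F x y = (if x \<subseteq> y then 0 else 1)" for x y
    have "expectation (\<lambda>\<omega>. F (X n \<omega>) (X (Suc n) \<omega>)) = 0"
      by (subst step_expectation1[OF n]) (simp add: F_def grow_def subset_insertI)
    moreover have "integrable M (\<lambda>\<omega>. F (X n \<omega>) (X (Suc n) \<omega>))" using n by (intro integrable_X2) auto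
    ultimately have "AE \<omega> in M. F (X n \<omega>) (X (Suc n) \<omega>) = 0"
      by (subst (asm) integral_nonneg_eq_0_iff_AE) (auto simp: F_def)
    then show ?thesis by eventually_elim (simp add: F_def split: if_splits)
  qed simp
qed

section \<open>Second moments of the residual\<close>

lemma harmonic_martingale:
  assumes f: "harmonic f" and m: "1 \<le> m" "m \<le> n"
  shows "expectation (\<lambda>\<omega>. g (X m \<omega>) * (f (X n \<omega>) / real n)) = expectation (\<lambda>\<omega>. g (X m \<omega>) * (f (X m \<omega>) / real m))"
  using m(2)
proof (induction rule: dec_induct)
  case (step n)
  have "expectation (\<lambda>\<omega>. g (X m \<omega>) * (f (X (Suc n) \<omega>) / real (Suc n)))
    = expectation (\<lambda>\<omega>. (\<Sum>v\<in>X n \<omega>. g (X m \<omega>) * (f (grow (X n \<omega>) v) / real (Suc n))) / real n)"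
    using step_expectation[of m n "\<lambda>a b c. g a * (f c / real (Suc n))"] m step by simp
  also have "\<dots> = expectation (\<lambda>\<omega>. g (X m \<omega>) * (f (X n \<omega>) / real n))"
  proof (intro Bochner_Integration.integral_cong refl)
    fix \<omega> assume "\<omega> \<in> space M"
    then have x: "X n \<omega> \<in> harris_trees n" using X_mem m step by auto
    have "(\<Sum>v\<in>X n \<omega>. g (X m \<omega>) * (f (grow (X n \<omega>) v) / real (Suc n))) / real n
      = g (X m \<omega>) * ((\<Sum>v\<in>X n \<omega>. f (grow (X n \<omega>) v) / real (Suc n)) / real n)"
      by (simp add: sum_distrib_left del: of_nat_Suc)
    also have "1 \<le> n" using m step by simp
    then have "(\<Sum>v\<in>X n \<omega>. f (grow (X n \<omega>) v) / real (Suc n)) / real n = f (X n \<omega>) / real n"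
      by (rule harmonic_step[OF f x])
    finally show "(\<Sum>v\<in>X n \<omega>. g (X m \<omega>) * (f (grow (X n \<omega>) v) / real (Suc n))) / real n = g (X m \<omega>) * (f (X n \<omega>) / real n)" .
  qed
  also have "\<dots> = expectation (\<lambda>\<omega>. g (X m \<omega>) * (f (X m \<omega>) / real m))" by (rule step.IH)
  finally show ?case .
qed simp

lemma harmonic_step_L2:
  fixes c :: "nat list set \<Rightarrow> real"
  assumes f: "harmonic f" and m: "1 \<le> m" "m \<le> n"
  shows "expectation (\<lambda>\<omega>. (f (X (Suc n) \<omega>) / real (Suc n) - c (X m \<omega>))\<^sup>2)
     \<le> expectation (\<lambda>\<omega>. (f (X n \<omega>) / real n - c (X m \<omega>))\<^sup>2)
      + expectation (\<lambda>\<omega>. (\<Sum>v\<in>X n \<omega>. (f (grow (X n \<omega>) v) - f (X n \<omega>))\<^sup>2) / real n) / (real (Suc n))\<^sup>2"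
proof -
  have n: "1 \<le> n" using m by simp
  let ?I = "\<lambda>\<omega>. (\<Sum>v\<in>X n \<omega>. (f (grow (X n \<omega>) v) - f (X n \<omega>))\<^sup>2) / real n"
  have i1: "integrable M (\<lambda>\<omega>. (f (X n \<omega>) / real n - c (X m \<omega>))\<^sup>2)"
    using integrable_X2[of m n "\<lambda>a b. (f b / real n - c a)\<^sup>2"] m n by simp
  have i2: "integrable M (\<lambda>\<omega>. ?I \<omega> / (real (Suc n))\<^sup>2)"
    using integrable_X[OF n, of "\<lambda>x. (\<Sum>v\<in>x. (f (grow x v) - f x)\<^sup>2) / real n / (real (Suc n))\<^sup>2"] by simp
  have i3: "integrable M (\<lambda>\<omega>. (\<Sum>v\<in>X n \<omega>. (f (grow (X n \<omega>) v) / real (Suc n) - c (X m \<omega>))\<^sup>2) / real n)"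
    using integrable_X2[of m n "\<lambda>a x. (\<Sum>v\<in>x. (f (grow x v) / real (Suc n) - c a)\<^sup>2) / real n"] m n by simp
  have "expectation (\<lambda>\<omega>. (f (X (Suc n) \<omega>) / real (Suc n) - c (X m \<omega>))\<^sup>2)
    = expectation (\<lambda>\<omega>. (\<Sum>v\<in>X n \<omega>. (f (grow (X n \<omega>) v) / real (Suc n) - c (X m \<omega>))\<^sup>2) / real n)"
    using step_expectation[OF m, of "\<lambda>a b d. (f d / real (Suc n) - c a)\<^sup>2"] by simp
  also have "\<dots> \<le> expectation (\<lambda>\<omega>. (f (X n \<omega>) / real n - c (X m \<omega>))\<^sup>2 + ?I \<omega> / (real (Suc n))\<^sup>2)"
    by (intro integral_mono i3 Bochner_Integration.integrable_add i1 i2 harmonic_step_sq[OF f _ n] X_mem n)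
  also have "\<dots> = expectation (\<lambda>\<omega>. (f (X n \<omega>) / real n - c (X m \<omega>))\<^sup>2) + expectation ?I / (real (Suc n))\<^sup>2"
    using i1 i2 by (simp add: Bochner_Integration.integral_add)
  finally show ?thesis .
qed

lemma expectation_TPL:
  assumes "1 \<le> n"
  shows "expectation (\<lambda>\<omega>. real (TPL (X n \<omega>)) / real n) = harm n - 1"
proof -
  have "expectation (\<lambda>\<omega>. centred_TPL (X n \<omega>) / real n) = expectation (\<lambda>\<omega>. centred_TPL (X 1 \<omega>) / real 1)"
    using harmonic_martingale[OF harmonic_centred_TPL, of 1 n "\<lambda>_. 1"] assms by simp
  also have "\<dots> = expectation (\<lambda>\<omega>. 0)"
    by (intro Bochner_Integration.integral_cong refl)
       (simp add: X_1[simplified] centred_TPL_def TPL_def nharm_def harm_expand)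
  finally have "expectation (\<lambda>\<omega>. centred_TPL (X n \<omega>) / real n) = 0" by simp
  moreover have "expectation (\<lambda>\<omega>. centred_TPL (X n \<omega>) / real n) = expectation (\<lambda>\<omega>. real (TPL (X n \<omega>)) / real n + (1 - harm n))"
    using assms by (intro Bochner_Integration.integral_cong refl)
      (auto simp: centred_TPL_def X_card nharm_def field_simps)
  moreover have "\<dots> = expectation (\<lambda>\<omega>. real (TPL (X n \<omega>)) / real n) + (1 - harm n)"
    using integrable_X[OF assms, of "\<lambda>x. real (TPL x) / real n"]
    by (subst Bochner_Integration.integral_add) (auto simp: prob_space)
  ultimately show ?thesis by linarith
qed

definition depth2 :: "nat list set \<Rightarrow> real" where
  "depth2 x = (\<Sum>v\<in>x. real ((length v + 1)\<^sup>2))"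

text \<open>
  Summing \<open>(length v + 2)\<^sup>2\<close> over the nodes expresses the drift of the squared depths by the path length,
  whose expectation is known. The resulting recursion is dominated by that of \<open>(H n)\<^sup>2 + H n\<close>.
\<close>

lemma expectation_depth2:
  assumes "1 \<le> n"
  shows "expectation (\<lambda>\<omega>. depth2 (X n \<omega>) / real n) \<le> (harm n)\<^sup>2 + harm n"
  using assms
proof (induction rule: dec_induct)
  case base
  have "expectation (\<lambda>\<omega>. depth2 (X 1 \<omega>) / real 1) = expectation (\<lambda>\<omega>. 1)"
    by (intro Bochner_Integration.integral_cong refl) (simp add: X_1[simplified] depth2_def)
  then show ?case by (simp add: prob_space harm_expand)
next
  case (step n)
  have n: "1 \<le> n" using step by simp
  have "expectation (\<lambda>\<omega>. depth2 (X (Suc n) \<omega>) / real (Suc n))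
    = expectation (\<lambda>\<omega>. (\<Sum>v\<in>X n \<omega>. depth2 (grow (X n \<omega>) v) / real (Suc n)) / real n)"
    by (rule step_expectation1[OF n])
  also have "\<dots> = expectation (\<lambda>\<omega>. depth2 (X n \<omega>) / real n + (2 * (real (TPL (X n \<omega>)) / real n) + 3) / real (Suc n))"
  proof (intro Bochner_Integration.integral_cong refl)
    fix \<omega> assume w: "\<omega> \<in> space M"
    let ?x = "X n \<omega>"
    note x = X_tree[OF n w] X_card[OF n w]
    have "(\<Sum>v\<in>?x. depth2 (grow ?x v)) = (\<Sum>v\<in>?x. depth2 ?x + (real ((length v + 1)\<^sup>2) + 2 * real (length v) + 3))"
      by (intro sum.cong refl) (simp add: depth2_def sum_grow[OF x(1)] new_node_def power2_eq_square algebra_simps)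
    also have "\<dots> = real n * depth2 ?x + (depth2 ?x + 2 * real (TPL ?x) + 3 * real n)"
      by (simp only: sum.distrib sum_constant x(2) sum_distrib_left[symmetric]) (simp add: depth2_def TPL_def)
    finally have S: "(\<Sum>v\<in>?x. depth2 (grow ?x v)) = real n * depth2 ?x + (depth2 ?x + 2 * real (TPL ?x) + 3 * real n)" .
    have "(\<Sum>v\<in>?x. depth2 (grow ?x v) / real (Suc n)) / real n
      = (real n * depth2 ?x + (depth2 ?x + 2 * real (TPL ?x) + 3 * real n)) / real (Suc n) / real n"
      by (simp only: sum_divide_distrib[symmetric] S)
    also have "\<dots> = depth2 ?x / real n + (2 * (real (TPL ?x) / real n) + 3) / real (Suc n)"
      using n by (simp add: divide_simps) (simp add: algebra_simps)
    finally show "(\<Sum>v\<in>?x. depth2 (grow ?x v) / real (Suc n)) / real n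
      = depth2 ?x / real n + (2 * (real (TPL ?x) / real n) + 3) / real (Suc n)" .
  qed
  also have "\<dots> = expectation (\<lambda>\<omega>. depth2 (X n \<omega>) / real n) + (2 * (harm n - 1) + 3) / real (Suc n)"
  proof -
    define a where "a \<omega> = real (TPL (X n \<omega>)) / real n" for \<omega>
    have "integrable M a" unfolding a_def using integrable_X[OF n, of "\<lambda>x. real (TPL x) / real n"] .
    moreover have "expectation a = harm n - 1" unfolding a_def by (rule expectation_TPL[OF n])
    ultimately have "integrable M (\<lambda>\<omega>. (2 * a \<omega> + 3) / real (Suc n))"
      "expectation (\<lambda>\<omega>. (2 * a \<omega> + 3) / real (Suc n)) = (2 * (harm n - 1) + 3) / real (Suc n)"
      by (simp_all add: prob_space del: of_nat_Suc)
    then show ?thesis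
      using integrable_X[OF n, of "\<lambda>x. depth2 x / real n"] unfolding a_def[symmetric]
      by (subst Bochner_Integration.integral_add) (simp_all del: of_nat_Suc)
  qed
  also have "\<dots> \<le> (harm n)\<^sup>2 + harm n + (2 * (harm n - 1) + 3) / real (Suc n)" using step by simp
  also have "\<dots> \<le> (harm (Suc n))\<^sup>2 + harm (Suc n)"
    by (simp add: harm_Suc power2_eq_square divide_inverse algebra_simps del: of_nat_Suc)
  finally show ?case .
qed

end

text \<open>
  The quadratic in \<open>H n\<close> is chosen such that the bound for a single squared increment is a difference
  of consecutive rates (\<open>rate_diff\<close>), so that the bounds for all increments sum up by telescoping.
\<close>

definition rate :: "nat \<Rightarrow> real" where
  "rate n = 3 * ((harm n)\<^sup>2 + 2 * harm n + 3) / real n"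

lemma harm_ge_1: "1 \<le> n \<Longrightarrow> 1 \<le> (harm n :: real)"
  using harm_mono[of 1 n, where 'a = real] by (simp add: harm_expand)

lemma rate_nonneg: "0 \<le> rate n"
  by (simp add: rate_def harm_nonneg)

lemma rate_diff:
  assumes "1 \<le> n" shows "(2 * (harm n)\<^sup>2 + harm n) / (real (Suc n))\<^sup>2 \<le> rate n - rate (Suc n)"
proof -
  define h :: real where "h = harm n"
  define N where "N = real n"
  have h: "1 \<le> h" using harm_ge_1[OF assms] by (simp add: h_def)
  have N: "1 \<le> N" using assms by (simp add: N_def)
  have hh: "h \<le> h\<^sup>2" using h by (simp add: power2_eq_square)
  define s where "s = 1 / N"
  define t where "t = 1 / (N + 1)"
  have st: "s - t = s * t" "0 < t" "t \<le> s" "t \<le> 1"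
    using N by (auto simp: s_def t_def field_simps)
  have "rate n - rate (Suc n) = 3 * ((h\<^sup>2 + 2 * h + 3) * s - ((h + t)\<^sup>2 + 2 * (h + t) + 3) * t)"
    by (simp add: rate_def harm_Suc h_def N_def s_def t_def inverse_eq_divide add.commute right_diff_distrib)
  also have "(h\<^sup>2 + 2 * h + 3) * s - ((h + t)\<^sup>2 + 2 * (h + t) + 3) * t
      = (h\<^sup>2 + 2 * h + 3) * (s - t) - (2 * h + 2 + t) * (t * t)"
    by (simp add: power2_eq_square algebra_simps)
  finally have r: "rate n - rate (Suc n) = 3 * ((h\<^sup>2 + 2 * h + 3) * (s * t) - (2 * h + 2 + t) * (t * t))"
    unfolding st(1) .
  have "(2 * h + 2 + t) * (t * t) \<le> (2 * h + 3) * (s * t)"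
    using st h by (intro mult_mono) auto
  then have "3 * (h\<^sup>2 * (s * t)) \<le> rate n - rate (Suc n)"
    unfolding r by (simp add: algebra_simps)
  moreover have "(2 * h\<^sup>2 + h) * (t * t) \<le> (3 * h\<^sup>2) * (s * t)"
    using st hh h by (intro mult_mono) auto
  moreover have "(2 * h\<^sup>2 + h) / (real (Suc n))\<^sup>2 = (2 * h\<^sup>2 + h) * (t * t)"
    by (simp add: t_def N_def power2_eq_square add.commute)
  ultimately show ?thesis by (simp add: h_def)
qed

context harris_process
begin

text \<open>
  For \<open>k = 0\<close> this is the normalized and centred path length of the theorem (\<open>R_eq\<close>).
\<close>

definition R :: "nat \<Rightarrow> nat \<Rightarrow> 'w \<Rightarrow> real" where
  "R k n \<omega> = residual k (X n \<omega>) / real n"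

lemma expectation_residual_increment:
  assumes n: "1 \<le> n"
  shows "expectation (\<lambda>\<omega>. (\<Sum>v\<in>X n \<omega>. (residual k (grow (X n \<omega>) v) - residual k (X n \<omega>))\<^sup>2) / real n)
     \<le> (if n \<le> k then 0 else 2 * (harm n)\<^sup>2 + harm n)"
proof -
  have "expectation (\<lambda>\<omega>. (\<Sum>v\<in>X n \<omega>. (residual k (grow (X n \<omega>) v) - residual k (X n \<omega>))\<^sup>2) / real n)
     \<le> expectation (\<lambda>\<omega>. if n \<le> k then 0 else depth2 (X n \<omega>) / real n + (harm n)\<^sup>2)"
  proof (rule integral_mono)
    fix \<omega> assume w: "\<omega> \<in> space M"
    let ?x = "X n \<omega>"
    note x = X_tree[OF n w] X_card[OF n w]
    have "(\<Sum>v\<in>?x. (residual k (grow ?x v) - residual k ?x)\<^sup>2)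
      \<le> (\<Sum>v\<in>?x. (if n \<le> k then 0 else real ((length v + 1)\<^sup>2) + (harm n)\<^sup>2))"
      by (intro sum_mono) (rule residual_grow_sq[OF x(1), of _ k, unfolded x(2)])
    then have "(\<Sum>v\<in>?x. (residual k (grow ?x v) - residual k ?x)\<^sup>2)
      \<le> (if n \<le> k then 0 else depth2 ?x + real n * (harm n)\<^sup>2)"
      using x(2) by (cases "n \<le> k") (simp_all add: depth2_def sum.distrib)
    then have "(\<Sum>v\<in>?x. (residual k (grow ?x v) - residual k ?x)\<^sup>2) / real n
      \<le> (if n \<le> k then 0 else depth2 ?x + real n * (harm n)\<^sup>2) / real n"
      by (rule divide_right_mono) simp
    then show "(\<Sum>v\<in>?x. (residual k (grow ?x v) - residual k ?x)\<^sup>2) / real n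
      \<le> (if n \<le> k then 0 else depth2 ?x / real n + (harm n)\<^sup>2)"
      using n by (simp add: add_divide_distrib split: if_splits)
  next
    show "integrable M (\<lambda>\<omega>. (\<Sum>v\<in>X n \<omega>. (residual k (grow (X n \<omega>) v) - residual k (X n \<omega>))\<^sup>2) / real n)"
      using integrable_X[OF n, of "\<lambda>x. (\<Sum>v\<in>x. (residual k (grow x v) - residual k x)\<^sup>2) / real n"] by simp
    show "integrable M (\<lambda>\<omega>. if n \<le> k then 0 else depth2 (X n \<omega>) / real n + (harm n)\<^sup>2)"
      using integrable_X[OF n, of "\<lambda>x. if n \<le> k then 0 else depth2 x / real n + (harm n)\<^sup>2"] by simp
  qed
  also have "\<dots> \<le> (if n \<le> k then 0 else 2 * (harm n)\<^sup>2 + harm n)"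
    using expectation_depth2[OF n] integrable_X[OF n, of "\<lambda>x. depth2 x / real n"]
    by (auto simp: prob_space)
  finally show ?thesis .
qed

text \<open>
  Up to time \<open>k\<close> the residual does not move. From then on the bound telescopes.
\<close>

lemma R_step:
  assumes "1 \<le> m" "m \<le> n"
  shows "expectation (\<lambda>\<omega>. (R k (Suc n) \<omega> - c (X m \<omega>))\<^sup>2)
     \<le> expectation (\<lambda>\<omega>. (R k n \<omega> - c (X m \<omega>))\<^sup>2) + (if n \<le> k then 0 else rate n - rate (Suc n))"
proof -
  have n: "1 \<le> n" using assms by simp
  have "expectation (\<lambda>\<omega>. (\<Sum>v\<in>X n \<omega>. (residual k (grow (X n \<omega>) v) - residual k (X n \<omega>))\<^sup>2) / real n) / (real (Suc n))\<^sup>2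
    \<le> (if n \<le> k then 0 else 2 * (harm n)\<^sup>2 + harm n) / (real (Suc n))\<^sup>2"
    by (intro divide_right_mono expectation_residual_increment[OF n]) simp
  also have "\<dots> \<le> (if n \<le> k then 0 else rate n - rate (Suc n))"
    using rate_diff[OF n] by simp
  finally show ?thesis
    using harmonic_step_L2[OF harmonic_residual[of k] assms, of c] unfolding R_def by simp
qed

lemma R_increment_L2:
  assumes m: "1 \<le> m" "m \<le> n"
  shows "expectation (\<lambda>\<omega>. (R k n \<omega> - R k m \<omega>)\<^sup>2) \<le> rate m"
proof -
  have "expectation (\<lambda>\<omega>. (R k n \<omega> - R k m \<omega>)\<^sup>2) \<le> rate m - rate n"
    using m(2)
  proof (induction rule: dec_induct)
    case (step n)
    have "expectation (\<lambda>\<omega>. (R k (Suc n) \<omega> - R k m \<omega>)\<^sup>2)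
       \<le> expectation (\<lambda>\<omega>. (R k n \<omega> - R k m \<omega>)\<^sup>2) + (if n \<le> k then 0 else rate n - rate (Suc n))"
      using R_step[OF m(1), of n k "\<lambda>x. residual k x / real m"] step by (simp add: R_def)
    also have "0 \<le> rate n - rate (Suc n)"
      using rate_diff[of n] m step by (intro order_trans[OF _ rate_diff]) (auto simp: harm_nonneg)
    then have "(if n \<le> k then 0 else rate n - rate (Suc n)) \<le> rate n - rate (Suc n)" by simp
    finally show ?case using step by simp
  qed simp
  then show ?thesis using rate_nonneg[of n] by simp
qed

lemma R_L2:
  assumes k: "1 \<le> k" and n: "1 \<le> n"
  shows "expectation (\<lambda>\<omega>. (R k n \<omega>)\<^sup>2) \<le> rate k"
proof -
  have one: "expectation (\<lambda>\<omega>. (R k (Suc n) \<omega>)\<^sup>2)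
       \<le> expectation (\<lambda>\<omega>. (R k n \<omega>)\<^sup>2) + (if n \<le> k then 0 else rate n - rate (Suc n))" if "1 \<le> n" for n
    using R_step[of n n k "\<lambda>_. 0"] that by simp
  have "expectation (\<lambda>\<omega>. (R k n \<omega>)\<^sup>2) \<le> (if n \<le> k then 0 else rate k - rate n)"
    using n
  proof (induction rule: dec_induct)
    case base
    have "expectation (\<lambda>\<omega>. (R k 1 \<omega>)\<^sup>2) = expectation (\<lambda>\<omega>. 0)"
      by (intro Bochner_Integration.integral_cong refl) (simp add: R_def X_1[simplified] residual_root)
    then show ?case using k by simp
  next
    case (step n)
    have "0 \<le> rate n - rate (Suc n)"
      using rate_diff[of n] step by (intro order_trans[OF _ rate_diff]) (auto simp: harm_nonneg)
    then show ?case using one[of n] step by (cases "n = k") (auto split: if_splits)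
  qed
  then show ?thesis using rate_nonneg[of n] rate_nonneg[of k] by (simp split: if_splits)
qed

end

section \<open>Uniform truncation of the entropy series\<close>

lemma harm_diff_le_ln: "1 \<le> a \<Longrightarrow> a \<le> b \<Longrightarrow> harm b - harm a \<le> ln (real b / real a)"
  using euler_mascheroni_sequence_decreasing[of a b] by (simp add: ln_div)

text \<open>
  The finite version of \<open>- s * ln s\<close>, where \<open>s\<close> is the share of the child \<open>u @ [i]\<close> among the nodes below \<open>u\<close>, times the
  number of these nodes.
\<close>

definition entropy_term :: "nat list set \<Rightarrow> nat list \<Rightarrow> nat \<Rightarrow> real" where
  "entropy_term x u i = real (weight x (u @ [i])) * (harm (weight x u) - harm (weight x (u @ [i])))"

lemma weight_snoc_le: "harris_tree x \<Longrightarrow> weight x (u @ [i]) \<le> weight x u"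
  by (rule weight_mono[OF harris_tree_finite]) auto

lemma entropy_term_nonneg: "harris_tree x \<Longrightarrow> 0 \<le> entropy_term x u i"
  unfolding entropy_term_def using weight_snoc_le[of x u i] by (simp add: harm_mono)

lemma toll_eq_entropy_term:
  assumes x: "harris_tree x"
  shows "toll x u = real (weight x u) - (if u \<in> x then harm (weight x u) else 0) - (\<Sum>i=1..card x. entropy_term x u i)"
proof -
  have "(\<Sum>i=1..card x. entropy_term x u i)
      = harm (weight x u) * (\<Sum>i=1..card x. real (weight x (u @ [i]))) - (\<Sum>i=1..card x. nharm (weight x (u @ [i])))"
    by (simp add: entropy_term_def nharm_def sum_distrib_left sum_subtractf algebra_simps)
  then show ?thesis
    unfolding toll_def sum_children_weight[OF x] nharm_def right_diff_distrib
    by (cases "u \<in> x") (simp_all add: mult.commute)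
qed

text \<open>
  Large values of \<open>- y * ln y\<close> relative to \<open>y\<close> need \<open>y\<close> to be very small. The bound \<open>ln z \<le> z - 1\<close> at
  \<open>z = 1 / (y * i\<^sup>2)\<close> makes this precise; it reduces the tail of the entropy series to a first moment of the child
  index and a convergent series.
\<close>

lemma neg_entropy_le:
  fixes y :: real
  assumes "0 < y" "1 \<le> i"
  shows "y * ln (1 / y) \<le> 2 * (real i * y) + 1 / (real i)\<^sup>2"
proof -
  have i: "real i \<ge> 1" using assms by simp
  have "ln (1 / (y * (real i)\<^sup>2)) \<le> 1 / (y * (real i)\<^sup>2) - 1"
    using assms i by (intro ln_le_minus_one) auto
  moreover have "ln (1 / (y * (real i)\<^sup>2)) = ln (1 / y) - 2 * ln (real i)"
    using assms i by (simp add: ln_div ln_mult ln_realpow)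
  ultimately have "y * ln (1 / y) \<le> y * (2 * ln (real i) + (1 / (y * (real i)\<^sup>2) - 1))"
    using assms by (intro mult_left_mono) auto
  also have "\<dots> = 2 * (ln (real i) * y) + 1 / (real i)\<^sup>2 - y"
    using assms i by (simp add: field_simps)
  also have "ln (real i) * y \<le> real i * y"
    using assms i by (intro mult_right_mono) (auto intro: order_trans[OF ln_le_minus_one])
  finally show ?thesis using assms by simp
qed

lemma entropy_term_le_ln:
  assumes x: "x \<in> harris_trees n" and pos: "0 < weight x (u @ [i])"
  shows "entropy_term x u i / real n \<le> real (weight x (u @ [i])) / real n * ln (1 / (real (weight x (u @ [i])) / real n))"
proof -
  have xx: "harris_tree x" "card x = n" using x by (auto simp: harris_trees_iff)
  let ?a = "weight x (u @ [i])" and ?b = "weight x u"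
  have ab: "1 \<le> ?a" "?a \<le> ?b" "?b \<le> n"
    using pos weight_snoc_le[OF xx(1)] weight_le_card[OF harris_tree_finite[OF xx(1)], of u] xx(2) by auto
  have "harm ?b - harm ?a \<le> ln (real ?b / real ?a)" by (rule harm_diff_le_ln[OF ab(1,2)])
  also have "\<dots> \<le> ln (real n / real ?a)"
    using ab by (intro ln_mono) (auto intro!: divide_right_mono)
  finally have "real ?a / real n * (harm ?b - harm ?a) \<le> real ?a / real n * ln (real n / real ?a)"
    by (intro mult_left_mono) auto
  then show ?thesis by (simp add: entropy_term_def)
qed

lemma entropy_term_le:
  assumes x: "x \<in> harris_trees n" and i: "1 \<le> i"
  shows "entropy_term x u i / real n \<le> 2 * (real i * (real (weight x (u @ [i])) / real n)) + 1 / (real i)\<^sup>2"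
proof (cases "weight x (u @ [i]) = 0")
  case True
  then show ?thesis by (simp add: entropy_term_def)
next
  case False
  have "0 < n" using x harris_tree_nodes by (auto simp: harris_trees_iff harris_tree_def card_gt_0_iff)
  then show ?thesis
    using entropy_term_le_ln[OF x, of u i] neg_entropy_le[of "real (weight x (u @ [i])) / real n" i] False i by simp
qed

text \<open>
  This first moment is itself controlled by a martingale argument: apart from the harmonic growth, it only
  increases when \<open>u\<close> is the parent of the new node.
\<close>

definition tail_moment :: "nat \<Rightarrow> nat list \<Rightarrow> nat list set \<Rightarrow> real" where
  "tail_moment L u x = (\<Sum>i=Suc L..card x. real i * real (weight x (u @ [i])))"

lemma num_children_grow: "harris_tree x \<Longrightarrow> v \<in> x \<Longrightarrow> num_children (grow x v) u = num_children x u + (if v = u then 1 else 0)"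
proof -
  assume x: "harris_tree x" and v: "v \<in> x"
  have "{i. u @ [i] \<in> grow x v} = (if v = u then insert (Suc (num_children x v)) {i. u @ [i] \<in> x} else {i. u @ [i] \<in> x})"
    by (auto simp: grow_def new_node_def)
  then show ?thesis unfolding num_children_def
    using children_eq[OF x, of u] by (auto simp: num_children_def[symmetric])
qed

lemma tail_moment_grow:
  assumes x: "harris_tree x" and v: "v \<in> x"
  shows "tail_moment L u (grow x v) \<le> tail_moment L u x
    + (\<Sum>i=Suc L..card x. if prefix (u @ [i]) v then real i else 0) + (if v = u then real (Suc (num_children x u)) else 0)"
proof -
  let ?b = "Suc (card x)"
  have "tail_moment L u (grow x v) = (\<Sum>i=Suc L..?b. real i * real (weight x (u @ [i]))
      + (if prefix (u @ [i]) v then real i else 0) + (if v = u \<and> i = Suc (num_children x u) then real i else 0))"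
    unfolding tail_moment_def card_grow[OF x] weight_grow[OF x] prefix_new_node
    using harris_tree_prefix[OF x v] new_node_notin[OF x, of v]
    by (intro sum.cong) (auto simp: new_node_def algebra_simps)
  also have "\<dots> = (\<Sum>i=Suc L..?b. real i * real (weight x (u @ [i])))
      + (\<Sum>i=Suc L..?b. if prefix (u @ [i]) v then real i else 0)
      + (\<Sum>i=Suc L..?b. if v = u \<and> i = Suc (num_children x u) then real i else 0)"
    by (simp only: sum.distrib)
  also have "(\<Sum>i=Suc L..?b. real i * real (weight x (u @ [i]))) = tail_moment L u x"
    unfolding tail_moment_def
    using sum_children_extend[OF x, of ?b "\<lambda>i w. real i * real w" u "Suc L"] by simp
  also have "(\<Sum>i=Suc L..?b. if prefix (u @ [i]) v then real i else 0)
      = (\<Sum>i=Suc L..card x. if prefix (u @ [i]) v then real i else 0)"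
  proof (rule sum.mono_neutral_right)
    show "\<forall>i\<in>{Suc L..?b} - {Suc L..card x}. (if prefix (u @ [i]) v then real i else 0) = 0"
      using harris_tree_prefix[OF x v] snoc_mem_less_card[OF x] by force
  qed auto
  also have "(\<Sum>i=Suc L..?b. if v = u \<and> i = Suc (num_children x u) then real i else 0) \<le> (if v = u then real (Suc (num_children x u)) else 0)"
    by (cases "v = u") (auto simp: sum.delta)
  finally show ?thesis by simp
qed

context harris_process
begin

text \<open>
  A node is chosen as parent at time \<open>n\<close> with probability at most \<open>1 / n\<close>.
\<close>

lemma expectation_num_children: "expectation (\<lambda>\<omega>. real (num_children (X (Suc n) \<omega>) u)) \<le> harm n"
proof (induction n)
  case 0
  have "expectation (\<lambda>\<omega>. real (num_children (X 1 \<omega>) u)) = expectation (\<lambda>\<omega>. 0)"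
    by (intro Bochner_Integration.integral_cong refl) (simp add: X_1[simplified] num_children_def)
  then show ?case by (simp add: harm_nonneg)
next
  case (Suc m)
  define n where "n = Suc m"
  have n: "1 \<le> n" by (simp add: n_def)
  have "expectation (\<lambda>\<omega>. real (num_children (X (Suc n) \<omega>) u)) = expectation (\<lambda>\<omega>. (\<Sum>v\<in>X n \<omega>. real (num_children (grow (X n \<omega>) v) u)) / real n)"
    by (rule step_expectation1[OF n])
  also have "\<dots> \<le> expectation (\<lambda>\<omega>. real (num_children (X n \<omega>) u) + 1 / real n)"
  proof (rule integral_mono)
    fix \<omega> assume w: "\<omega> \<in> space M"
    note x = X_tree[OF n w] X_card[OF n w]
    have "(\<Sum>v\<in>X n \<omega>. real (num_children (grow (X n \<omega>) v) u)) = (\<Sum>v\<in>X n \<omega>. real (num_children (X n \<omega>) u) + (if v = u then 1 else 0))"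
      by (intro sum.cong refl) (simp add: num_children_grow[OF x(1)])
    also have "\<dots> \<le> real n * real (num_children (X n \<omega>) u) + 1"
      using harris_tree_finite[OF x(1)] x(2) by (simp add: sum.distrib)
    finally have "(\<Sum>v\<in>X n \<omega>. real (num_children (grow (X n \<omega>) v) u)) / real n \<le> (real n * real (num_children (X n \<omega>) u) + 1) / real n"
      by (rule divide_right_mono) simp
    then show "(\<Sum>v\<in>X n \<omega>. real (num_children (grow (X n \<omega>) v) u)) / real n \<le> real (num_children (X n \<omega>) u) + 1 / real n"
      using n by (simp add: add_divide_distrib)
  qed (use integrable_X[OF n, of "\<lambda>x. (\<Sum>v\<in>x. real (num_children (grow x v) u)) / real n"]
        integrable_X[OF n, of "\<lambda>x. real (num_children x u) + 1 / real n"] in auto)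
  also have "\<dots> = expectation (\<lambda>\<omega>. real (num_children (X n \<omega>) u)) + 1 / real n"
    using integrable_X[OF n, of "\<lambda>x. real (num_children x u)"] by (simp add: prob_space)
  finally show ?case using Suc by (simp add: n_def harm_Suc inverse_eq_divide)
qed

text \<open>
  A child with index above \<open>L\<close> cannot exist at time \<open>L\<close>, so the moment starts from zero. The bound
  telescopes the increments \<open>(H n + 1) / (n * (n + 1))\<close>.
\<close>

lemma expectation_tail_moment:
  assumes L: "1 \<le> L" and n: "L \<le> n"
  shows "expectation (\<lambda>\<omega>. tail_moment L u (X n \<omega>) / real n) \<le> (harm L + 2) / real L - (harm n + 2) / real n"
  using n
proof (induction rule: dec_induct)
  case base
  have "expectation (\<lambda>\<omega>. tail_moment L u (X L \<omega>) / real L) = expectation (\<lambda>\<omega>. 0)"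
    by (intro Bochner_Integration.integral_cong refl) (simp add: tail_moment_def X_card[OF L])
  then have "expectation (\<lambda>\<omega>. tail_moment L u (X L \<omega>) / real L) = 0" by (simp only: Bochner_Integration.integral_zero)
  then show ?case by (simp only: diff_self order_refl)
next
  case (step n)
  have n: "1 \<le> n" using step L by simp
  define s where "s = 1 / real n"
  define t where "t = 1 / real (Suc n)"
  have st: "s - t = s * t" "0 < t" "t \<le> s"
    using n by (auto simp: s_def t_def field_simps)
  let ?T = "tail_moment L u" and ?d = "\<lambda>x. real (Suc (num_children x u))"
  have "expectation (\<lambda>\<omega>. ?T (X (Suc n) \<omega>) / real (Suc n))
      = expectation (\<lambda>\<omega>. (\<Sum>v\<in>X n \<omega>. ?T (grow (X n \<omega>) v) / real (Suc n)) / real n)"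
    by (rule step_expectation1[OF n])
  also have "\<dots> \<le> expectation (\<lambda>\<omega>. ?T (X n \<omega>) / real n + ?d (X n \<omega>) * (s * t))"
  proof (rule integral_mono)
    fix \<omega> assume w: "\<omega> \<in> space M"
    let ?x = "X n \<omega>"
    note x = X_tree[OF n w] X_card[OF n w]
    note fin = harris_tree_finite[OF x(1)]
    have "(\<Sum>v\<in>?x. ?T (grow ?x v)) \<le> (\<Sum>v\<in>?x. ?T ?x
        + (\<Sum>i=Suc L..n. if prefix (u @ [i]) v then real i else 0) + (if v = u then ?d ?x else 0))"
      by (intro sum_mono) (use tail_moment_grow[OF x(1)] x(2) in auto)
    also have "\<dots> = real n * ?T ?x + (\<Sum>i=Suc L..n. \<Sum>v\<in>?x. if prefix (u @ [i]) v then real i else 0)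
        + (\<Sum>v\<in>?x. if v = u then ?d ?x else 0)"
      by (simp only: sum.distrib sum.swap[of _ _ "{Suc L..n}"] sum_constant x(2))
    also have "(\<Sum>i=Suc L..n. \<Sum>v\<in>?x. if prefix (u @ [i]) v then real i else 0) = ?T ?x"
      unfolding sum_prefix_weight[OF fin] tail_moment_def x(2) by (simp add: mult.commute)
    also have "(\<Sum>v\<in>?x. if v = u then ?d ?x else 0) \<le> ?d ?x"
      using fin by simp
    finally have "(\<Sum>v\<in>?x. ?T (grow ?x v)) * (s * t) \<le> (real n * ?T ?x + ?T ?x + ?d ?x) * (s * t)"
      using st by (intro mult_right_mono) auto
    moreover have "(real n * ?T ?x + ?T ?x) * (s * t) = ?T ?x / real n"
    proof -
      have "real n * ?T ?x + ?T ?x = real (Suc n) * ?T ?x" by (simp add: algebra_simps)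
      then show ?thesis by (simp add: s_def t_def del: of_nat_Suc)
    qed
    moreover have "(\<Sum>v\<in>?x. ?T (grow ?x v) / real (Suc n)) / real n = (\<Sum>v\<in>?x. ?T (grow ?x v)) * (s * t)"
      by (simp only: sum_divide_distrib[symmetric]) (simp add: s_def t_def mult.commute)
    ultimately show "(\<Sum>v\<in>?x. ?T (grow ?x v) / real (Suc n)) / real n \<le> ?T ?x / real n + ?d ?x * (s * t)"
      by (simp only: distrib_right)
  qed (use integrable_X[OF n, of "\<lambda>x. (\<Sum>v\<in>x. ?T (grow x v) / real (Suc n)) / real n"]
        integrable_X[OF n, of "\<lambda>x. ?T x / real n + ?d x * (s * t)"] in simp_all)
  also have "\<dots> = expectation (\<lambda>\<omega>. ?T (X n \<omega>) / real n) + expectation (\<lambda>\<omega>. real (num_children (X n \<omega>) u) + 1) * (s * t)"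
    using integrable_X[OF n, of "\<lambda>x. ?T x / real n"] integrable_X[OF n, of "\<lambda>x. real (num_children x u)"]
    by (subst Bochner_Integration.integral_add) (auto simp: add.commute)
  also have "\<dots> \<le> ((harm L + 2) / real L - (harm n + 2) * s) + (harm n + 1) * (s * t)"
  proof (intro add_mono mult_right_mono)
    have "expectation (\<lambda>\<omega>. real (num_children (X n \<omega>) u) + 1) = expectation (\<lambda>\<omega>. real (num_children (X n \<omega>) u)) + 1"
      using integrable_X[OF n, of "\<lambda>x. real (num_children x u)"] by (simp add: prob_space)
    also have "expectation (\<lambda>\<omega>. real (num_children (X n \<omega>) u)) \<le> harm (n - 1)"
      using expectation_num_children[of "n - 1" u] n by simp
    also have "harm (n - 1) \<le> (harm n :: real)" by (rule harm_mono) simp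
    finally show "expectation (\<lambda>\<omega>. real (num_children (X n \<omega>) u) + 1) \<le> harm n + 1" by simp
  qed (use step st in \<open>auto simp: s_def\<close>)
  also have "\<dots> \<le> (harm L + 2) / real L - (harm (Suc n) + 2) * t"
  proof -
    have "(harm n + 2) * s - (harm (Suc n) + 2) * t = (harm n + 2) * (s - t) - t * t"
      by (simp add: harm_Suc t_def inverse_eq_divide algebra_simps del: of_nat_Suc)
    also have "\<dots> = (harm n + 1) * (s * t) + (s - t) * t"
      unfolding st(1) by (simp add: st(1)[symmetric] algebra_simps)
    also have "\<dots> \<ge> (harm n + 1) * (s * t)" using st by simp
    finally show ?thesis by simp
  qed
  finally show ?case by (simp add: t_def)
qed

end

lemma sum_inverse_square_tail:
  assumes "1 \<le> L" "L \<le> n" shows "(\<Sum>i=Suc L..n. 1 / (real i)\<^sup>2) \<le> 1 / real L - 1 / real n"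
  using assms(2)
proof (induction rule: dec_induct)
  case (step n)
  have "1 / (real (Suc n))\<^sup>2 \<le> 1 / real n - 1 / real (Suc n)"
  proof -
    have "1 / (real (Suc n))\<^sup>2 \<le> 1 / (real n * real (Suc n))"
      using assms step by (intro divide_left_mono) (auto simp: power2_eq_square)
    also have "\<dots> = 1 / real n - 1 / real (Suc n)"
      using assms step by (simp add: field_simps)
    finally show ?thesis .
  qed
  then show ?case using step by simp
qed simp

definition tail_bound :: "nat \<Rightarrow> real" where
  "tail_bound L = 2 * ((harm L + 2) / real L) + 1 / real L"

lemma harm_le_ln: "1 \<le> n \<Longrightarrow> harm n \<le> 1 + ln (real n)"
  using harm_diff_le_ln[of 1 n] by (simp add: harm_expand)

lemma harm_over_n: "(\<lambda>n. harm n / real n) \<longlonglongrightarrow> 0"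
proof (rule tendsto_sandwich[OF _ _ tendsto_const])
  show "\<forall>\<^sub>F n in sequentially. harm n / real n \<le> (1 + ln (real n)) / real n"
    using eventually_ge_at_top[of 1] by eventually_elim (auto intro!: divide_right_mono harm_le_ln)
  show "(\<lambda>n. (1 + ln (real n)) / real n) \<longlonglongrightarrow> 0" by real_asymp
qed (simp add: harm_nonneg)

lemma tail_bound_tendsto: "tail_bound \<longlonglongrightarrow> 0"
proof -
  have "(\<lambda>L. 2 * (harm L / real L) + 5 * (1 / real L)) \<longlonglongrightarrow> 2 * 0 + 5 * 0"
    by (intro tendsto_intros harm_over_n lim_1_over_n)
  moreover have "tail_bound = (\<lambda>L. 2 * (harm L / real L) + 5 * (1 / real L))"
    by (auto simp: tail_bound_def add_divide_distrib)
  ultimately show ?thesis by simp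
qed

lemma rate_tendsto: "rate \<longlonglongrightarrow> 0"
proof (rule tendsto_sandwich[OF _ _ tendsto_const])
  show "\<forall>\<^sub>F n in sequentially. rate n \<le> 3 * ((1 + ln (real n))\<^sup>2 + 2 * (1 + ln (real n)) + 3) / real n"
    using eventually_ge_at_top[of 1]
  proof eventually_elim
    case (elim n)
    have h: "harm n \<le> 1 + ln (real n)" "0 \<le> (harm n :: real)" using harm_le_ln elim harm_nonneg by auto
    then have sq: "(harm n)\<^sup>2 \<le> (1 + ln (real n))\<^sup>2" by (intro power_mono) auto
    have "3 * ((harm n)\<^sup>2 + 2 * harm n + 3) \<le> 3 * ((1 + ln (real n))\<^sup>2 + 2 * (1 + ln (real n)) + 3)"
      by (intro mult_left_mono add_mono sq h(1) order_refl) simp_all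
    then show ?case unfolding rate_def by (rule divide_right_mono) simp
  qed
  show "(\<lambda>n. 3 * ((1 + ln (real n))\<^sup>2 + 2 * (1 + ln (real n)) + 3) / real n) \<longlonglongrightarrow> 0" by real_asymp
qed (simp add: rate_nonneg)

definition trunc_toll :: "nat \<Rightarrow> nat list set \<Rightarrow> nat list \<Rightarrow> real" where
  "trunc_toll L x u = real (weight x u) - (if u \<in> x then harm (weight x u) else 0) - (\<Sum>i=1..L. entropy_term x u i)"

lemma trunc_toll_diff:
  assumes "harris_tree x" "L \<le> card x"
  shows "trunc_toll L x u - toll x u = (\<Sum>i=Suc L..card x. entropy_term x u i)"
proof -
  have "{1..card x} = {1..L} \<union> {Suc L..card x}" using assms by auto
  then have "(\<Sum>i=1..card x. entropy_term x u i) = (\<Sum>i=1..L. entropy_term x u i) + (\<Sum>i=Suc L..card x. entropy_term x u i)"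
    by (simp add: sum.union_disjoint)
  then show ?thesis by (simp add: trunc_toll_def toll_eq_entropy_term[OF assms(1)])
qed

text \<open>
  The counterpart of a partial sum of \<open>Y\<close> with all entropy series cut off after \<open>L\<close> terms. Divided by the size of the tree, such a
  finite sum converges along every path on which the relative subtree sizes converge.
\<close>

definition trunc_sum :: "nat \<Rightarrow> nat \<Rightarrow> nat list set \<Rightarrow> real" where
  "trunc_sum k L x = (\<Sum>u\<in>small_nodes k. trunc_toll L x u)"

lemma (in prob_space) expectation_abs_le:
  assumes "integrable M f" "integrable M (\<lambda>\<omega>. (f \<omega>)\<^sup>2)" "expectation (\<lambda>\<omega>. (f \<omega>)\<^sup>2) \<le> B"
  shows "expectation (\<lambda>\<omega>. \<bar>f \<omega>\<bar>) \<le> sqrt (B :: real)"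
proof -
  have "variance (\<lambda>\<omega>. \<bar>f \<omega>\<bar>) = expectation (\<lambda>\<omega>. (\<bar>f \<omega>\<bar>)\<^sup>2) - (expectation (\<lambda>\<omega>. \<bar>f \<omega>\<bar>))\<^sup>2"
    by (rule variance_eq) (use assms in auto)
  moreover have "0 \<le> variance (\<lambda>\<omega>. \<bar>f \<omega>\<bar>)" by simp
  ultimately have "(expectation (\<lambda>\<omega>. \<bar>f \<omega>\<bar>))\<^sup>2 \<le> B" using assms by simp
  then show ?thesis using real_le_rsqrt by blast
qed

context harris_process
begin

lemma expectation_entropy_term_tail:
  assumes L: "1 \<le> L" "L \<le> n"
  shows "expectation (\<lambda>\<omega>. (\<Sum>i=Suc L..n. entropy_term (X n \<omega>) u i) / real n) \<le> tail_bound L"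
proof -
  have n: "1 \<le> n" using L by simp
  have "expectation (\<lambda>\<omega>. (\<Sum>i=Suc L..n. entropy_term (X n \<omega>) u i) / real n)
    \<le> expectation (\<lambda>\<omega>. 2 * (tail_moment L u (X n \<omega>) / real n) + 1 / real L)"
  proof (rule integral_mono)
    fix \<omega> assume w: "\<omega> \<in> space M"
    have "(\<Sum>i=Suc L..n. entropy_term (X n \<omega>) u i) / real n
      \<le> (\<Sum>i=Suc L..n. 2 * (real i * (real (weight (X n \<omega>) (u @ [i])) / real n)) + 1 / (real i)\<^sup>2)"
      unfolding sum_divide_distrib by (intro sum_mono entropy_term_le X_mem n w) simp
    also have "\<dots> = 2 * (tail_moment L u (X n \<omega>) / real n) + (\<Sum>i=Suc L..n. 1 / (real i)\<^sup>2)"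
      by (simp add: sum.distrib tail_moment_def X_card[OF n w] sum_distrib_left sum_divide_distrib)
    also have "(\<Sum>i=Suc L..n. 1 / (real i)\<^sup>2) \<le> 1 / real L"
      using sum_inverse_square_tail[OF L] by (rule order_trans) simp
    finally show "(\<Sum>i=Suc L..n. entropy_term (X n \<omega>) u i) / real n \<le> 2 * (tail_moment L u (X n \<omega>) / real n) + 1 / real L"
      by simp
  qed (use integrable_X[OF n, of "\<lambda>x. (\<Sum>i=Suc L..n. entropy_term x u i) / real n"]
        integrable_X[OF n, of "\<lambda>x. 2 * (tail_moment L u x / real n) + 1 / real L"] in simp_all)
  also have "\<dots> = 2 * expectation (\<lambda>\<omega>. tail_moment L u (X n \<omega>) / real n) + 1 / real L"
    using integrable_X[OF n, of "\<lambda>x. tail_moment L u x / real n"]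
    by (subst Bochner_Integration.integral_add) (simp_all add: prob_space del: times_divide_eq_right)
  also have "expectation (\<lambda>\<omega>. tail_moment L u (X n \<omega>) / real n) \<le> (harm L + 2) / real L"
    using expectation_tail_moment[OF L, of u] by (rule order_trans) (simp add: harm_nonneg)
  finally show ?thesis by (simp add: tail_bound_def)
qed

text \<open>
  The martingale at time \<open>n\<close> is compared with that at a later time \<open>m\<close>, which differs from the
  normalized sum of tolls by the residual, and the tolls are then truncated. The bound does not depend on \<open>m\<close>.
\<close>

lemma expectation_trunc_sum:
  assumes n: "1 \<le> n" "n \<le> m" and L: "1 \<le> L" "L \<le> m" and k: "1 \<le> k"
  shows "expectation (\<lambda>\<omega>. \<bar>R 0 n \<omega> - trunc_sum k L (X m \<omega>) / real m\<bar>)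
    \<le> sqrt (rate n) + sqrt (rate k) + real (card (small_nodes k)) * tail_bound L"
proof -
  have m: "1 \<le> m" using n by simp
  let ?t = "\<lambda>\<omega>. \<Sum>u\<in>small_nodes k. (\<Sum>i=Suc L..m. entropy_term (X m \<omega>) u i) / real m"
  have i1: "integrable M (\<lambda>\<omega>. R 0 m \<omega> - R 0 n \<omega>)"
    using integrable_X2[OF m n(1), of "\<lambda>x y. residual 0 x / real m - residual 0 y / real n"] by (simp add: R_def)
  have i1': "integrable M (\<lambda>\<omega>. (R 0 m \<omega> - R 0 n \<omega>)\<^sup>2)"
    using integrable_X2[OF m n(1), of "\<lambda>x y. (residual 0 x / real m - residual 0 y / real n)\<^sup>2"] by (simp add: R_def)
  have i2: "integrable M (R k m)" "integrable M (\<lambda>\<omega>. (R k m \<omega>)\<^sup>2)"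
    using integrable_X[OF m, of "\<lambda>x. residual k x / real m"] integrable_X[OF m, of "\<lambda>x. (residual k x / real m)\<^sup>2"]
    by (simp_all add: R_def[abs_def])
  have i3: "integrable M (\<lambda>\<omega>. (\<Sum>i=Suc L..m. entropy_term (X m \<omega>) u i) / real m)" for u
    using integrable_X[OF m, of "\<lambda>x. (\<Sum>i=Suc L..m. entropy_term x u i) / real m"] .
  have i4: "integrable M ?t" by (rule Bochner_Integration.integrable_sum) (rule i3)
  have i5: "integrable M (\<lambda>\<omega>. \<bar>R 0 n \<omega> - trunc_sum k L (X m \<omega>) / real m\<bar>)"
    using integrable_X2[OF n(1) m, of "\<lambda>x y. \<bar>residual 0 x / real n - trunc_sum k L y / real m\<bar>"] by (simp add: R_def)
  have "expectation (\<lambda>\<omega>. \<bar>R 0 n \<omega> - trunc_sum k L (X m \<omega>) / real m\<bar>)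
     \<le> expectation (\<lambda>\<omega>. \<bar>R 0 m \<omega> - R 0 n \<omega>\<bar> + \<bar>R k m \<omega>\<bar> + ?t \<omega>)"
  proof (rule integral_mono)
    fix \<omega> assume w: "\<omega> \<in> space M"
    note x = X_tree[OF m w] X_card[OF m w]
    have "trunc_sum k L (X m \<omega>) - (\<Sum>u\<in>small_nodes k. toll (X m \<omega>) u) = (\<Sum>u\<in>small_nodes k. \<Sum>i=Suc L..m. entropy_term (X m \<omega>) u i)"
      using trunc_toll_diff[OF x(1), of L] L x(2) by (simp add: trunc_sum_def sum_subtractf[symmetric])
    then have a: "trunc_sum k L (X m \<omega>) = residual 0 (X m \<omega>) - residual k (X m \<omega>) + (\<Sum>u\<in>small_nodes k. \<Sum>i=Suc L..m. entropy_term (X m \<omega>) u i)"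
      by (simp add: residual_def small_nodes_def)
    have "trunc_sum k L (X m \<omega>) / real m = R 0 m \<omega> - R k m \<omega> + ?t \<omega>"
      unfolding a R_def by (simp add: add_divide_distrib diff_divide_distrib sum_divide_distrib)
    moreover have "0 \<le> ?t \<omega>" by (intro sum_nonneg divide_nonneg_nonneg entropy_term_nonneg x) auto
    ultimately show "\<bar>R 0 n \<omega> - trunc_sum k L (X m \<omega>) / real m\<bar> \<le> \<bar>R 0 m \<omega> - R 0 n \<omega>\<bar> + \<bar>R k m \<omega>\<bar> + ?t \<omega>"
      by linarith
  qed (intro i5 i1 i2 i4 Bochner_Integration.integrable_add integrable_abs)+
  also have "\<dots> = expectation (\<lambda>\<omega>. \<bar>R 0 m \<omega> - R 0 n \<omega>\<bar>) + expectation (\<lambda>\<omega>. \<bar>R k m \<omega>\<bar>)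
      + (\<Sum>u\<in>small_nodes k. expectation (\<lambda>\<omega>. (\<Sum>i=Suc L..m. entropy_term (X m \<omega>) u i) / real m))"
    using i1 i2 i3 i4 by (simp add: Bochner_Integration.integral_add Bochner_Integration.integral_sum del: Bochner_Integration.integral_divide_zero)
  also have "\<dots> \<le> sqrt (rate n) + sqrt (rate k) + (\<Sum>u\<in>small_nodes k. tail_bound L)"
    by (intro add_mono sum_mono expectation_abs_le i1 i1' i2 R_increment_L2 R_L2 expectation_entropy_term_tail L n k m)
  finally show ?thesis by simp
qed

end

section \<open>Passage to the limit along a path\<close>

text \<open>
  If \<open>b > 0\<close>, both weights tend to infinity and the Euler constants in the asymptotics of the harmonic numbers
  cancel. If \<open>b = 0\<close>, the term is at most \<open>- y * ln y \<le> 2 * sqrt y\<close>, where \<open>y \<rightarrow> b\<close>. With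
  \<open>0 * ln (a / 0) = 0\<close> the formula for the limit covers both cases.
\<close>

lemma entropy_term_limit:
  assumes x: "\<And>m. 1 \<le> m \<Longrightarrow> x m \<in> harris_trees m"
    and a: "(\<lambda>m. real (weight (x m) u) / real m) \<longlonglongrightarrow> a"
    and b: "(\<lambda>m. real (weight (x m) (u @ [i])) / real m) \<longlonglongrightarrow> b"
  shows "(\<lambda>m. entropy_term (x m) u i / real m) \<longlonglongrightarrow> b * ln (a / b)"
    and "0 \<le> b" "b \<le> a"
proof -
  let ?A = "\<lambda>m. weight (x m) u" and ?B = "\<lambda>m. weight (x m) (u @ [i])"
  show b0: "0 \<le> b" by (rule LIMSEQ_le_const[OF b]) auto
  have BA: "?B m \<le> ?A m" if "1 \<le> m" for m
    using x[OF that] by (auto simp: harris_trees_iff weight_snoc_le)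
  show ba: "b \<le> a"
    by (rule LIMSEQ_le[OF b a]) (use BA in \<open>auto intro!: exI[of _ 1] divide_right_mono\<close>)
  show "(\<lambda>m. entropy_term (x m) u i / real m) \<longlonglongrightarrow> b * ln (a / b)"
  proof (cases "b = 0")
    case True
    have "(\<lambda>m. 2 * sqrt (real (?B m) / real m)) \<longlonglongrightarrow> 2 * sqrt b"
      by (intro tendsto_intros b)
    then have lim: "(\<lambda>m. 2 * sqrt (real (?B m) / real m)) \<longlonglongrightarrow> 0" using True by simp
    have "(\<lambda>m. entropy_term (x m) u i / real m) \<longlonglongrightarrow> 0"
    proof (rule tendsto_sandwich[OF _ _ tendsto_const lim])
      show "\<forall>\<^sub>F m in sequentially. 0 \<le> entropy_term (x m) u i / real m"
        using eventually_ge_at_top[of 1] 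
      proof eventually_elim
        case (elim m)
        then show ?case using entropy_term_nonneg x[OF elim] by (simp add: harris_trees_iff)
      qed
      show "\<forall>\<^sub>F m in sequentially. entropy_term (x m) u i / real m \<le> 2 * sqrt (real (?B m) / real m)"
        using eventually_ge_at_top[of 1]
      proof eventually_elim
        case (elim m)
        show ?case
        proof (cases "?B m = 0")
          case False
          define y where "y = real (?B m) / real m"
          have y: "y > 0" using False elim by (simp add: y_def)
          have "entropy_term (x m) u i / real m \<le> y * ln (1 / y)"
            using entropy_term_le_ln[OF x[OF elim], of u i] False by (simp add: y_def)
          also have "ln (1 / y) = 2 * ln (1 / sqrt y)"
            using y by (simp add: ln_div ln_sqrt)
          also have "y * (2 * ln (1 / sqrt y)) \<le> y * (2 * (1 / sqrt y))"
            using ln_le_minus_one[of "1 / sqrt y"] y by (intro mult_left_mono) simp_all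
          also have "y * (2 * (1 / sqrt y)) = 2 * sqrt y"
          proof -
            have "y * (2 * (1 / sqrt y)) = 2 * (y / sqrt y)" by simp
            then show ?thesis using real_div_sqrt[of y] y by simp
          qed
          finally show ?thesis using y by (simp add: y_def)
        qed (simp add: entropy_term_def)
      qed
    qed
    then show ?thesis using True by simp
  next
    case False
    then have bpos: "0 < b" "0 < a" using b0 ba by auto
    have infty: "filterlim (\<lambda>m. weight (x m) w) at_top sequentially"
      if "(\<lambda>m. real (weight (x m) w) / real m) \<longlonglongrightarrow> c" "0 < c" for w c
    proof -
      have "filterlim (\<lambda>m. real (weight (x m) w) / real m * real m) at_top sequentially"
        by (rule filterlim_tendsto_pos_mult_at_top[OF that filterlim_real_sequentially])
      then have "filterlim (\<lambda>m. real (weight (x m) w)) at_top sequentially"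
      proof (rule filterlim_at_top_mono)
        show "\<forall>\<^sub>F m in sequentially. real (weight (x m) w) / real m * real m \<le> real (weight (x m) w)"
          using eventually_ge_at_top[of 1] by eventually_elim simp
      qed
      then show ?thesis by (simp add: filterlim_sequentially_iff_filterlim_real)
    qed
    have "(\<lambda>m. (harm (?A m) - ln (real (?A m))) - (harm (?B m) - ln (real (?B m)))
        + ln ((real (?A m) / real m) / (real (?B m) / real m))) \<longlonglongrightarrow> euler_mascheroni - euler_mascheroni + ln (a / b)"
      by (intro tendsto_intros a b filterlim_compose[OF euler_mascheroni_LIMSEQ infty[OF a]]
          filterlim_compose[OF euler_mascheroni_LIMSEQ infty[OF b]]) (use bpos in auto)
    from tendsto_mult[OF b this]
    have "(\<lambda>m. real (?B m) / real m * ((harm (?A m) - ln (real (?A m))) - (harm (?B m) - ln (real (?B m)))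
        + ln ((real (?A m) / real m) / (real (?B m) / real m)))) \<longlonglongrightarrow> b * ln (a / b)"
      by (simp only: diff_self add_0_left)
    then show ?thesis
    proof (rule Lim_transform_eventually)
      show "\<forall>\<^sub>F m in sequentially. real (?B m) / real m * ((harm (?A m) - ln (real (?A m))) - (harm (?B m) - ln (real (?B m)))
        + ln ((real (?A m) / real m) / (real (?B m) / real m))) = entropy_term (x m) u i / real m"
        using eventually_ge_at_top[of 1]
      proof eventually_elim
        case (elim m)
        show ?case
        proof (cases "?B m = 0")
          case False
          then have "0 < ?B m" "0 < ?A m" using BA[OF elim] by auto
          then show ?thesis using elim by (simp add: ln_div entropy_term_def)
        qed (simp add: entropy_term_def)
      qed
    qed
  qed
qed

definition limit_trunc :: "(nat list \<Rightarrow> real) \<Rightarrow> nat \<Rightarrow> nat \<Rightarrow> real" where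
  "limit_trunc p k L = (\<Sum>u\<in>small_nodes k. p u - (\<Sum>i=1..L. p (u @ [i]) * ln (p u / p (u @ [i]))))"

lemma trunc_sum_limit:
  assumes x: "\<And>m. 1 \<le> m \<Longrightarrow> x m \<in> harris_trees m"
    and p: "\<And>u. u \<in> nodes \<Longrightarrow> (\<lambda>m. real (weight (x m) u) / real m) \<longlonglongrightarrow> p u"
  shows "(\<lambda>m. trunc_sum k L (x m) / real m) \<longlonglongrightarrow> limit_trunc p k L"
proof -
  have h0: "(\<lambda>m. (if u \<in> x m then harm (weight (x m) u) else 0) / real m) \<longlonglongrightarrow> 0" for u
  proof (rule tendsto_sandwich[OF _ _ tendsto_const harm_over_n])
    show "\<forall>\<^sub>F m in sequentially. (if u \<in> x m then harm (weight (x m) u) else 0) / real m \<le> harm m / real m"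
      using eventually_ge_at_top[of 1]
    proof eventually_elim
      case (elim m)
      have "weight (x m) u \<le> m"
        using x[OF elim] weight_le_card[OF harris_tree_finite, of "x m" u] by (auto simp: harris_trees_iff)
      then show ?case by (auto intro!: divide_right_mono harm_mono simp: harm_nonneg)
    qed
  qed (auto simp: harm_nonneg)
  have "(\<lambda>m. \<Sum>u\<in>small_nodes k. real (weight (x m) u) / real m - (if u \<in> x m then harm (weight (x m) u) else 0) / real m
      - (\<Sum>i=1..L. entropy_term (x m) u i / real m))
     \<longlonglongrightarrow> (\<Sum>u\<in>small_nodes k. p u - 0 - (\<Sum>i=1..L. p (u @ [i]) * ln (p u / p (u @ [i]))))"
    by (intro tendsto_sum tendsto_diff h0 p entropy_term_limit(1) x)
       (auto simp: small_nodes_def nodes_snoc)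
  then show ?thesis
    by (simp add: trunc_sum_def trunc_toll_def limit_trunc_def sum_divide_distrib diff_divide_distrib)
qed

text \<open>
  The truncated sums decrease in \<open>L\<close>. If one of the finitely many series diverged, they would tend
  to \<open>-\<infinity>\<close>.
\<close>

lemma liminf_truncations_finite_imp_summable:
  fixes z :: "'i \<Rightarrow> nat \<Rightarrow> real"
  assumes S: "finite S" and z: "\<And>u i. u \<in> S \<Longrightarrow> 1 \<le> i \<Longrightarrow> 0 \<le> z u i"
    and fin: "liminf (\<lambda>L. ennreal \<bar>r - (\<Sum>u\<in>S. p u - (\<Sum>i=1..L. z u i))\<bar>) \<noteq> \<infinity>"
    and u: "u \<in> S"
  shows "summable (\<lambda>i. z u (Suc i))"
proof -
  define T where "T L = (\<Sum>u\<in>S. \<Sum>i=1..L. z u i)" for L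
  have mono: "T L \<le> T L'" if "L \<le> L'" for L L'
    unfolding T_def using that z by (intro sum_mono sum_mono2) auto
  have "\<exists>B. \<forall>L. T L \<le> B"
  proof (rule ccontr)
    assume "\<not> ?thesis"
    then have unb: "\<exists>L. B < T L" for B by (meson not_le)
    have "of_nat c \<le> liminf (\<lambda>L. ennreal \<bar>r - (\<Sum>u\<in>S. p u - (\<Sum>i=1..L. z u i))\<bar>)" for c :: nat
    proof (rule Liminf_bounded)
      obtain L0 where L0: "real c + \<bar>\<Sum>u\<in>S. p u\<bar> + \<bar>r\<bar> < T L0" using unb by blast
      show "\<forall>\<^sub>F L in sequentially. of_nat c \<le> ennreal \<bar>r - (\<Sum>u\<in>S. p u - (\<Sum>i=1..L. z u i))\<bar>"
        using eventually_ge_at_top[of L0]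
      proof eventually_elim
        case (elim L)
        have "real c \<le> \<bar>r - ((\<Sum>u\<in>S. p u) - T L)\<bar>" using L0 mono[OF elim] by linarith
        then show ?case by (simp add: T_def sum_subtractf ennreal_of_nat_eq_real_of_nat ennreal_leI)
      qed
    qed
    then show False using fin ennreal_Ex_less_of_nat
      by (auto simp: less_top not_less[symmetric])
  qed
  then obtain B where B: "\<And>L. T L \<le> B" by blast
  show ?thesis
  proof (rule summableI_nonneg_bounded)
    fix n
    have "(\<Sum>i<n. z u (Suc i)) = (\<Sum>i=1..n. z u i)"
      by (simp add: sum.atLeast1_atMost_eq)
    also have "\<dots> \<le> T n" unfolding T_def
      by (rule member_le_sum[OF u _ S]) (auto intro!: sum_nonneg z)
    finally show "(\<Sum>i<n. z u (Suc i)) \<le> B" using B[of n] by linarith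
  qed (use z u in auto)
qed

text \<open>
  The extended real series in \<open>C_fun\<close> is an ordinary one once its terms are summable. The partial sum \<open>k\<close>
  includes the nodes with \<open>sum_list u = k\<close>, hence the shift to \<open>Suc k\<close>. Nodes of mass zero contribute nothing, since
  all terms of their series vanish.
\<close>

lemma Y_partial_limit:
  assumes p: "\<And>u. u \<in> nodes \<Longrightarrow> 0 \<le> measure \<mu> (cyl u)"
    and le: "\<And>u i. u \<in> nodes \<Longrightarrow> 1 \<le> i \<Longrightarrow> measure \<mu> (cyl (u @ [i])) \<le> measure \<mu> (cyl u)"
    and sm: "\<And>u. u \<in> small_nodes (Suc k) \<Longrightarrow>
       summable (\<lambda>i. measure \<mu> (cyl (u @ [Suc i])) * ln (measure \<mu> (cyl u) / measure \<mu> (cyl (u @ [Suc i]))))"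
  shows "limit_trunc (\<lambda>u. measure \<mu> (cyl u)) (Suc k) \<longlonglongrightarrow> real_of_ereal (Y_partial \<mu> k)"
proof -
  define P where "P u = measure \<mu> (cyl u)" for u
  define z where "z u i = P (u @ [i]) * ln (P u / P (u @ [i]))" for u i
  have S: "{u \<in> nodes. sum_list u \<le> k} = small_nodes (Suc k)" by (auto simp: small_nodes_def)
  have term_eq: "ereal (P u) * C_fun (rho \<mu> u) = ereal (P u - (\<Sum>i. z u (Suc i)))" if u: "u \<in> small_nodes (Suc k)" for u
  proof -
    have un: "u \<in> nodes" using u by (simp add: small_nodes_def)
    have zs: "summable (\<lambda>i. z u (Suc i))" using sm[OF u] by (simp add: z_def P_def)
    have r: "rho \<mu> u (Suc i) * ln (rho \<mu> u (Suc i)) = - z u (Suc i) / P u" for i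
    proof -
      have "0 \<le> P u" "0 \<le> P (u @ [Suc i])" "P (u @ [Suc i]) \<le> P u"
        using p[of u] p[of "u @ [Suc i]"] le[of u "Suc i"] un by (auto simp: P_def nodes_snoc)
      then show ?thesis
        by (cases "P (u @ [Suc i]) = 0") (auto simp: rho_def P_def[symmetric] z_def ln_div field_simps)
    qed
    have "(\<Sum>i. ereal (- z u (Suc i) / P u)) = ereal (\<Sum>i. - z u (Suc i) / P u)"
      by (intro suminf_ereal' summable_divide summable_minus zs)
    also have "(\<Sum>i. - z u (Suc i) / P u) = - (\<Sum>i. z u (Suc i)) / P u"
      using zs by (simp add: suminf_divide[symmetric] suminf_minus)
    finally have "C_fun (rho \<mu> u) = ereal (1 - (\<Sum>i. z u (Suc i)) / P u)"
      unfolding C_fun_def r by (simp add: one_ereal_def)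
    moreover have "P u * (1 - (\<Sum>i. z u (Suc i)) / P u) = P u - (\<Sum>i. z u (Suc i))"
    proof (cases "P u = 0")
      case True
      then have "z u (Suc i) = 0" for i by (simp add: z_def)
      then show ?thesis using True by simp
    next
      case False
      then show ?thesis by (simp add: field_simps)
    qed
    ultimately show ?thesis by simp
  qed
  have "Y_partial \<mu> k = (\<Sum>u\<in>small_nodes (Suc k). ereal (P u - (\<Sum>i. z u (Suc i))))"
    unfolding Y_partial_def S using term_eq by (intro sum.cong) (auto simp: P_def)
  then have Y: "real_of_ereal (Y_partial \<mu> k) = (\<Sum>u\<in>small_nodes (Suc k). P u - (\<Sum>i. z u (Suc i)))"
    by (simp add: sum_ereal)
  have "(\<lambda>L. \<Sum>u\<in>small_nodes (Suc k). P u - (\<Sum>i=1..L. z u i))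
     \<longlonglongrightarrow> (\<Sum>u\<in>small_nodes (Suc k). P u - (\<Sum>i. z u (Suc i)))"
  proof (intro tendsto_sum tendsto_diff tendsto_const)
    fix u assume "u \<in> small_nodes (Suc k)"
    then have "summable (\<lambda>i. z u (Suc i))" using sm by (simp add: z_def P_def)
    then have "(\<lambda>L. \<Sum>i<L. z u (Suc i)) \<longlonglongrightarrow> (\<Sum>i. z u (Suc i))" by (rule summable_LIMSEQ)
    then show "(\<lambda>L. \<Sum>i=1..L. z u i) \<longlonglongrightarrow> (\<Sum>i. z u (Suc i))"
      by (simp add: sum.atLeast1_atMost_eq)
  qed
  then show ?thesis unfolding Y by (simp add: limit_trunc_def[abs_def] P_def z_def)
qed

context harris_process
begin

text \<open>
  Fatou's lemma is applied to the time and then to the truncation. The second application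
  also yields convergence of the entropy series: the integral of the lower limit is finite, so the lower limit is
  finite almost everywhere, and the truncated sums cannot tend to \<open>-\<infinity>\<close>.
\<close>

lemma nn_integral_Y_partial:
  assumes Xinf: "doob_martin_limit M X Xinf" and n: "1 \<le> n"
  shows "(\<integral>\<^sup>+\<omega>. ennreal \<bar>R 0 n \<omega> - real_of_ereal (Y_partial (Xinf \<omega>) k)\<bar> \<partial>M)
    \<le> ennreal (sqrt (rate n) + sqrt (rate (Suc k)))"
proof -
  define p where "p \<omega> u = measure (Xinf \<omega>) (cyl u)" for \<omega> u
  define g where "g L \<omega> = limit_trunc (p \<omega>) (Suc k) L" for L \<omega>
  let ?B = "\<lambda>L. sqrt (rate n) + sqrt (rate (Suc k)) + real (card (small_nodes (Suc k))) * tail_bound L"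
  have meas_p: "(\<lambda>\<omega>. p \<omega> u) \<in> borel_measurable M" if "u \<in> nodes" for u
  proof -
    have "cyl u \<in> sets Vbar_algebra"
      unfolding Vbar_algebra_def using that by (subst sets_measure_of) (auto simp: cyl_def)
    then show ?thesis unfolding p_def
      using Xinf measurable_compose[OF _ measurable_measure_prob_algebra] by (auto simp: doob_martin_limit_def)
  qed
  have meas_g: "g L \<in> borel_measurable M" for L
    unfolding g_def limit_trunc_def
    by (intro borel_measurable_sum borel_measurable_diff borel_measurable_times borel_measurable_ln
        borel_measurable_divide meas_p) (auto simp: small_nodes_def nodes_snoc)
  have meas_R: "R 0 n \<in> borel_measurable M"
    using measurable_X[OF n, of "\<lambda>x. residual 0 x / real n"] by (simp add: R_def[abs_def])
  have lim: "AE \<omega> in M. \<forall>u\<in>nodes. (\<lambda>m. real (weight (X m \<omega>) u) / real m) \<longlonglongrightarrow> p \<omega> u"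
  proof -
    have "AE \<omega> in M. \<forall>u\<in>nodes. (\<lambda>m. real (card (subtree (X m \<omega>) u)) / real m) \<longlonglongrightarrow> p \<omega> u"
      using Xinf by (simp add: doob_martin_limit_def p_def)
    with AE_space show ?thesis
    proof eventually_elim
      case (elim \<omega>)
      show ?case
      proof
        fix u assume u: "u \<in> nodes"
        show "(\<lambda>m. real (weight (X m \<omega>) u) / real m) \<longlonglongrightarrow> p \<omega> u"
        proof (rule Lim_transform_eventually[OF elim(2)[rule_format, OF u]])
          show "\<forall>\<^sub>F m in sequentially. real (card (subtree (X m \<omega>) u)) / real m = real (weight (X m \<omega>) u) / real m"
            using eventually_ge_at_top[of 1]
            by eventually_elim (simp add: card_subtree[OF X_tree] elim(1))
        qed
      qed
    qed
  qed
  have bound_g: "(\<integral>\<^sup>+\<omega>. ennreal \<bar>R 0 n \<omega> - g L \<omega>\<bar> \<partial>M) \<le> ennreal (?B L)" if L: "1 \<le> L" for L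
  proof -
    \<comment> \<open>the maximum restricts attention to the times for which the bound of the expectation holds\<close>
    let ?f = "\<lambda>m \<omega>. \<bar>R 0 n \<omega> - trunc_sum (Suc k) L (X (max m (max n L)) \<omega>) / real (max m (max n L))\<bar>"
    have "(\<integral>\<^sup>+\<omega>. ennreal \<bar>R 0 n \<omega> - g L \<omega>\<bar> \<partial>M) = (\<integral>\<^sup>+\<omega>. liminf (\<lambda>m. ennreal (?f m \<omega>)) \<partial>M)"
    proof (rule nn_integral_cong_AE)
      show "AE \<omega> in M. ennreal \<bar>R 0 n \<omega> - g L \<omega>\<bar> = liminf (\<lambda>m. ennreal (?f m \<omega>))"
        using lim AE_space
      proof eventually_elim
        case (elim \<omega>)
        have "(\<lambda>m. trunc_sum (Suc k) L (X m \<omega>) / real m) \<longlonglongrightarrow> g L \<omega>"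
          unfolding g_def by (rule trunc_sum_limit) (use elim X_mem in auto)
        moreover have "filterlim (\<lambda>m. max m (max n L)) sequentially sequentially"
          by (rule filterlim_at_top_mono[OF filterlim_ident]) auto
        ultimately have "(\<lambda>m. trunc_sum (Suc k) L (X (max m (max n L)) \<omega>) / real (max m (max n L))) \<longlonglongrightarrow> g L \<omega>"
          by (rule filterlim_compose)
        then have "(\<lambda>m. ennreal (?f m \<omega>)) \<longlonglongrightarrow> ennreal \<bar>R 0 n \<omega> - g L \<omega>\<bar>"
          by (intro tendsto_intros tendsto_ennrealI)
        then show ?case by (intro lim_imp_Liminf[symmetric]) auto
      qed
    qed
    also have "\<dots> \<le> liminf (\<lambda>m. \<integral>\<^sup>+\<omega>. ennreal (?f m \<omega>) \<partial>M)"
    proof (rule nn_integral_liminf)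
      fix m
      have "1 \<le> max m (max n L)" using n by simp
      then have "(\<lambda>\<omega>. trunc_sum (Suc k) L (X (max m (max n L)) \<omega>) / real (max m (max n L))) \<in> borel_measurable M"
        by (rule measurable_X)
      then show "(\<lambda>\<omega>. ennreal (?f m \<omega>)) \<in> borel_measurable M" using meas_R by measurable
    qed
    also have "\<dots> \<le> ennreal (?B L)"
    proof (rule Liminf_le)
      show "\<forall>\<^sub>F m in sequentially. (\<integral>\<^sup>+\<omega>. ennreal (?f m \<omega>) \<partial>M) \<le> ennreal (?B L)"
      proof (rule always_eventually, rule allI)
        fix m
        let ?m = "max m (max n L)"
        have "(\<integral>\<^sup>+\<omega>. ennreal (?f m \<omega>) \<partial>M) = ennreal (expectation (?f m))"
          using integrable_X2[of n ?m "\<lambda>x y. \<bar>residual 0 x / real n - trunc_sum (Suc k) L y / real ?m\<bar>"] n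
          by (intro nn_integral_eq_integral) (auto simp: R_def)
        also have "\<dots> \<le> ennreal (?B L)"
          by (intro ennreal_leI expectation_trunc_sum n L) auto
        finally show "(\<integral>\<^sup>+\<omega>. ennreal (?f m \<omega>) \<partial>M) \<le> ennreal (?B L)" .
      qed
    qed simp
    finally show ?thesis .
  qed
  let ?h = "\<lambda>\<omega>. liminf (\<lambda>L. ennreal \<bar>R 0 n \<omega> - g L \<omega>\<bar>)"
  have "(\<integral>\<^sup>+\<omega>. ?h \<omega> \<partial>M) \<le> liminf (\<lambda>L. \<integral>\<^sup>+\<omega>. ennreal \<bar>R 0 n \<omega> - g L \<omega>\<bar> \<partial>M)"
    by (rule nn_integral_liminf) (use meas_R meas_g in measurable)
  also have "\<dots> \<le> liminf (\<lambda>L. ennreal (?B L))"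
    by (rule Liminf_mono) (rule eventually_mono[OF eventually_ge_at_top[of 1] bound_g])
  also have "\<dots> = ennreal (sqrt (rate n) + sqrt (rate (Suc k)) + real (card (small_nodes (Suc k))) * 0)"
    by (intro lim_imp_Liminf tendsto_ennrealI tendsto_intros tail_bound_tendsto) auto
  finally have h: "(\<integral>\<^sup>+\<omega>. ?h \<omega> \<partial>M) \<le> ennreal (sqrt (rate n) + sqrt (rate (Suc k)))" by simp
  have "AE \<omega> in M. ?h \<omega> \<noteq> \<infinity>"
  proof (rule nn_integral_noteq_infinite)
    show "?h \<in> borel_measurable M" using meas_R meas_g by measurable
    show "(\<integral>\<^sup>+\<omega>. ?h \<omega> \<partial>M) \<noteq> \<infinity>" using h by (auto simp: top_unique)
  qed
  with lim AE_space have "AE \<omega> in M. ennreal \<bar>R 0 n \<omega> - real_of_ereal (Y_partial (Xinf \<omega>) k)\<bar> = ?h \<omega>"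
  proof eventually_elim
    case (elim \<omega>)
    have x: "\<And>m. 1 \<le> m \<Longrightarrow> X m \<omega> \<in> harris_trees m" using elim X_mem by auto
    note xl = entropy_term_limit[OF x elim(1)[rule_format] elim(1)[rule_format]]
    have le: "p \<omega> (u @ [i]) \<le> p \<omega> u" "0 \<le> p \<omega> (u @ [i])" if "u \<in> nodes" "1 \<le> i" for u i
      using xl(2,3)[of u i] that by (auto simp: nodes_snoc)
    have z: "0 \<le> p \<omega> (u @ [i]) * ln (p \<omega> u / p \<omega> (u @ [i]))" if "u \<in> nodes" "1 \<le> i" for u i
      using le[OF that] by (cases "p \<omega> (u @ [i]) = 0") (auto simp: field_simps)
    have "(\<lambda>L. g L \<omega>) \<longlonglongrightarrow> real_of_ereal (Y_partial (Xinf \<omega>) k)"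
      unfolding g_def p_def
    proof (rule Y_partial_limit)
      fix u assume u: "u \<in> small_nodes (Suc k)"
      have "summable (\<lambda>i. p \<omega> (u @ [Suc i]) * ln (p \<omega> u / p \<omega> (u @ [Suc i])))"
        by (rule liminf_truncations_finite_imp_summable[OF finite_small_nodes[of "Suc k"] _ _ u, of _ "R 0 n \<omega>" "p \<omega>"])
           (use z elim(3) in \<open>auto simp: small_nodes_def g_def limit_trunc_def\<close>)
      then show "summable (\<lambda>i. measure (Xinf \<omega>) (cyl (u @ [Suc i])) *
          ln (measure (Xinf \<omega>) (cyl u) / measure (Xinf \<omega>) (cyl (u @ [Suc i]))))" by (simp add: p_def)
    qed (use le in \<open>auto simp: p_def\<close>)
    then have "(\<lambda>L. ennreal \<bar>R 0 n \<omega> - g L \<omega>\<bar>) \<longlonglongrightarrow> ennreal \<bar>R 0 n \<omega> - real_of_ereal (Y_partial (Xinf \<omega>) k)\<bar>"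
      by (intro tendsto_intros tendsto_ennrealI)
    then show ?case by (intro lim_imp_Liminf[symmetric]) auto
  qed
  then show ?thesis using h by (subst nn_integral_cong_AE) auto
qed

end

section \<open>From subsequences and moments to convergence\<close>

lemma real_power6_ratio: "(\<lambda>k. real (Suc k ^ 6) / real (k ^ 6)) \<longlonglongrightarrow> 1"
  unfolding of_nat_power of_nat_Suc by real_asymp

text \<open>
  Between \<open>k ^ 6\<close> and \<open>(k + 1) ^ 6\<close> the sequence \<open>t n / n\<close> is squeezed between quotients of values of \<open>t\<close> at the
  end points. These quotients are of order \<open>ln k\<close>, and the relative length of the interval is of order \<open>1 / k\<close>, so
  the two bounds have the same limit.
\<close>

lemma monotone_interpolation:
  fixes t :: "nat \<Rightarrow> real"
  assumes mono: "\<And>m n. 1 \<le> m \<Longrightarrow> m \<le> n \<Longrightarrow> t m \<le> t n" and nonneg: "\<And>n. 0 \<le> t n"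
    and lim: "(\<lambda>k. t (Suc k ^ 6) / real (Suc k ^ 6) - harm (Suc k ^ 6) + 1) \<longlonglongrightarrow> y"
  shows "(\<lambda>n. t n / real n - harm n + 1) \<longlonglongrightarrow> y"
proof -
  define a :: "nat \<Rightarrow> nat" where "a k = k ^ 6" for k
  define h :: "nat \<Rightarrow> real" where "h k = harm (a k)" for k
  define g where "g k = t (a k) / real (a k) - h k + 1" for k
  define r where "r k = real (a (Suc k)) / real (a k)" for k
  have g: "g \<longlonglongrightarrow> y"
    using lim unfolding g_def[abs_def] h_def a_def by (subst (asm) filterlim_sequentially_Suc)
  have g': "(\<lambda>k. g (Suc k)) \<longlonglongrightarrow> y" using g by (subst filterlim_sequentially_Suc)
  have r: "r \<longlonglongrightarrow> 1" unfolding r_def[abs_def] a_def by (rule real_power6_ratio)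
  have h_le: "h k \<le> 1 + 6 * ln (real k)" if "1 \<le> k" for k
    using harm_le_ln[of "a k"] that by (simp add: h_def a_def ln_realpow)
  have h_nonneg: "0 \<le> h k" for k by (simp add: h_def harm_nonneg)
  have r1: "1 \<le> r k" if "1 \<le> k" for k
    using that by (simp add: r_def a_def power_mono)
  have dh: "(\<lambda>k. h (Suc k) - h k) \<longlonglongrightarrow> 0"
  proof (rule tendsto_sandwich[OF _ _ tendsto_const])
    show "\<forall>\<^sub>F k in sequentially. 0 \<le> h (Suc k) - h k"
      by (simp add: h_def a_def harm_mono power_mono)
    show "\<forall>\<^sub>F k in sequentially. h (Suc k) - h k \<le> ln (r k)"
      using eventually_ge_at_top[of 1]
    proof eventually_elim
      case (elim k)
      then have "1 \<le> a k" "a k \<le> a (Suc k)" by (auto simp: a_def power_mono)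
      then show ?case unfolding h_def r_def by (rule harm_diff_le_ln)
    qed
    show "(\<lambda>k. ln (r k)) \<longlonglongrightarrow> 0" using tendsto_ln[OF r] by simp
  qed
  have up: "(\<lambda>k. h (Suc k) * (r k - 1)) \<longlonglongrightarrow> 0"
  proof (rule tendsto_sandwich[OF _ _ tendsto_const])
    show "\<forall>\<^sub>F k in sequentially. 0 \<le> h (Suc k) * (r k - 1)"
      using eventually_ge_at_top[of 1] by eventually_elim (use r1 h_nonneg in simp)
    show "\<forall>\<^sub>F k in sequentially. h (Suc k) * (r k - 1) \<le> (1 + 6 * ln (real k + 1)) * ((real k + 1) ^ 6 / real k ^ 6 - 1)"
      using eventually_ge_at_top[of 1]
    proof eventually_elim
      case (elim k)
      have "h (Suc k) * (r k - 1) \<le> (1 + 6 * ln (real (Suc k))) * (r k - 1)"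
        using h_le[of "Suc k"] r1[OF elim] by (intro mult_right_mono) auto
      then show ?case by (simp add: r_def a_def add.commute)
    qed
    show "(\<lambda>k. (1 + 6 * ln (real k + 1)) * ((real k + 1) ^ 6 / real k ^ 6 - 1)) \<longlonglongrightarrow> 0" by real_asymp
  qed
  have lo: "(\<lambda>k. h k * (1 - 1 / r k)) \<longlonglongrightarrow> 0"
  proof (rule tendsto_sandwich[OF _ _ tendsto_const up])
    show "\<forall>\<^sub>F k in sequentially. 0 \<le> h k * (1 - 1 / r k)"
      using eventually_ge_at_top[of 1]
    proof eventually_elim
      case (elim k)
      then show ?case using r1[OF elim] h_nonneg[of k] by (intro mult_nonneg_nonneg) (simp_all add: divide_le_eq_1)
    qed
    show "\<forall>\<^sub>F k in sequentially. h k * (1 - 1 / r k) \<le> h (Suc k) * (r k - 1)"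
      using eventually_ge_at_top[of 1]
    proof eventually_elim
      case (elim k)
      have "1 - 1 / r k = (r k - 1) / r k" using r1[OF elim] by (simp add: field_simps)
      also have "\<dots> \<le> r k - 1" using r1[OF elim] by (simp add: divide_le_eq mult_left_le_one_le mult_le_cancel_left1)
      finally have "1 - 1 / r k \<le> r k - 1" .
      moreover have "h k \<le> h (Suc k)" by (simp add: h_def a_def harm_mono power_mono)
      ultimately show ?case using r1[OF elim] h_nonneg by (intro mult_mono) auto
    qed
  qed
  have U: "(\<lambda>k. t (a (Suc k)) / real (a k) - h k + 1) \<longlonglongrightarrow> y"
  proof -
    have "(\<lambda>k. g (Suc k) + (g (Suc k) - 1) * (r k - 1) + h (Suc k) * (r k - 1) + (h (Suc k) - h k))
      \<longlonglongrightarrow> y + (y - 1) * (1 - 1) + 0 + 0"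
      by (intro tendsto_intros g' r up dh)
    then have "(\<lambda>k. g (Suc k) + (g (Suc k) - 1) * (r k - 1) + h (Suc k) * (r k - 1) + (h (Suc k) - h k))
      \<longlonglongrightarrow> y"
      by (simp only: diff_self mult_zero_right add_0_right)
    then show ?thesis
    proof (rule Lim_transform_eventually)
      show "\<forall>\<^sub>F k in sequentially. g (Suc k) + (g (Suc k) - 1) * (r k - 1) + h (Suc k) * (r k - 1) + (h (Suc k) - h k)
        = t (a (Suc k)) / real (a k) - h k + 1"
        using eventually_ge_at_top[of 1]
      proof eventually_elim
        case (elim k)
        have "(g (Suc k) + h (Suc k) - 1) * r k = t (a (Suc k)) / real (a k)"
          using elim by (simp add: g_def r_def a_def)
        then show ?case by (simp add: algebra_simps)
      qed
    qed
  qed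
  have Lo: "(\<lambda>k. t (a k) / real (a (Suc k)) - h (Suc k) + 1) \<longlonglongrightarrow> y"
  proof -
    have "(\<lambda>k. g k - (g k - 1) * (1 - 1 / r k) - h k * (1 - 1 / r k) - (h (Suc k) - h k))
      \<longlonglongrightarrow> y - (y - 1) * (1 - 1 / 1) - 0 - 0"
      by (intro tendsto_intros g r lo dh) simp
    then have "(\<lambda>k. g k - (g k - 1) * (1 - 1 / r k) - h k * (1 - 1 / r k) - (h (Suc k) - h k)) \<longlonglongrightarrow> y"
      by (simp only: div_by_1 diff_self mult_zero_right diff_0_right)
    then show ?thesis
    proof (rule Lim_transform_eventually)
      show "\<forall>\<^sub>F k in sequentially. g k - (g k - 1) * (1 - 1 / r k) - h k * (1 - 1 / r k) - (h (Suc k) - h k)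
        = t (a k) / real (a (Suc k)) - h (Suc k) + 1"
        using eventually_ge_at_top[of 1]
      proof eventually_elim
        case (elim k)
        have "(g k + h k - 1) * (1 / r k) = t (a k) / real (a (Suc k))"
          using elim by (simp add: g_def r_def a_def)
        then show ?case by (simp add: algebra_simps diff_divide_distrib)
      qed
    qed
  qed
  define \<kappa> where "\<kappa> n = (LEAST k. n < a (Suc k))" for n
  have \<kappa>_less: "n < a (Suc (\<kappa> n))" for n
  proof -
    have "n < a (Suc n)" using self_le_power[of "Suc n" 6] by (simp add: a_def)
    then show ?thesis unfolding \<kappa>_def by (rule LeastI)
  qed
  have \<kappa>_le: "a (\<kappa> n) \<le> n" for n
  proof (cases "\<kappa> n")
    case (Suc j)
    then have "\<not> n < a (Suc j)" using not_less_Least[of j "\<lambda>k. n < a (Suc k)"] by (simp add: \<kappa>_def)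
    then show ?thesis using Suc by simp
  qed (simp add: a_def)
  have \<kappa>_top: "filterlim \<kappa> sequentially sequentially"
    unfolding filterlim_at_top
  proof
    fix c
    show "\<forall>\<^sub>F n in sequentially. c \<le> \<kappa> n"
      using eventually_ge_at_top[of "a c"]
    proof eventually_elim
      case (elim n)
      then have "a c < a (Suc (\<kappa> n))" using \<kappa>_less[of n] by simp
      then have "c < Suc (\<kappa> n)" unfolding a_def by (rule power_less_imp_less_base) simp
      then show ?case by simp
    qed
  qed
  have bnd: "\<forall>\<^sub>F n in sequentially. t (a (\<kappa> n)) / real (a (Suc (\<kappa> n))) - h (Suc (\<kappa> n)) + 1 \<le> t n / real n - harm n + 1
     \<and> t n / real n - harm n + 1 \<le> t (a (Suc (\<kappa> n))) / real (a (\<kappa> n)) - h (\<kappa> n) + 1"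
    using eventually_ge_at_top[of 1]
  proof eventually_elim
    case (elim n)
    have k1: "1 \<le> a (\<kappa> n)"
    proof -
      have "\<kappa> n \<noteq> 0" using \<kappa>_less[of n] elim by (metis One_nat_def a_def leD power_one)
      then show ?thesis by (simp add: a_def)
    qed
    note kl = \<kappa>_le[of n] less_imp_le[OF \<kappa>_less[of n]]
    have "t (a (\<kappa> n)) / real (a (Suc (\<kappa> n))) \<le> t n / real n"
      using mono[OF k1 kl(1)] kl elim nonneg by (intro frac_le) auto
    moreover have "t n / real n \<le> t (a (Suc (\<kappa> n))) / real (a (\<kappa> n))"
      using mono[OF elim kl(2)] kl k1 nonneg by (intro frac_le) auto
    moreover have "h (\<kappa> n) \<le> harm n" "harm n \<le> h (Suc (\<kappa> n))"
      unfolding h_def using kl by (auto intro: harm_mono)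
    ultimately show ?case by linarith
  qed
  show ?thesis
    by (rule tendsto_sandwich[OF _ _ filterlim_compose[OF Lo \<kappa>_top] filterlim_compose[OF U \<kappa>_top]])
       (use bnd in \<open>auto elim: eventually_mono\<close>)
qed

text \<open>
  The power 6 makes these bounds summable even after the logarithm is estimated by \<open>k - 1\<close>.
\<close>

lemma sqrt_rate_le:
  assumes "1 \<le> k" shows "sqrt (rate (k ^ 6)) \<le> 26 / (real k)\<^sup>2"
proof -
  have k: "1 \<le> real k" "1 \<le> k ^ 6" using assms by auto
  let ?h = "harm (k ^ 6) :: real"
  have "?h \<le> 1 + 6 * ln (real k)" using harm_le_ln[OF k(2)] assms by (simp add: ln_realpow)
  also have "ln (real k) \<le> real k - 1" using k by (intro ln_le_minus_one) auto
  finally have h: "?h \<le> 6 * real k" using k by simp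
  have h1: "1 \<le> ?h" by (rule harm_ge_1[OF k(2)])
  have "?h \<le> ?h\<^sup>2" using self_le_power[OF h1, of 2] by simp
  moreover have "1 \<le> ?h\<^sup>2" using one_le_power[OF h1] .
  ultimately
  have "3 * (?h\<^sup>2 + 2 * ?h + 3) \<le> 18 * ?h\<^sup>2" by simp
  also have "\<dots> \<le> 18 * (6 * real k)\<^sup>2" using h h1 by (intro mult_left_mono power_mono) auto
  \<comment> \<open>the constant 26 of the claim comes from \<open>18 * 36 = 648 \<le> 26\<^sup>2\<close>\<close>
  finally have "rate (k ^ 6) \<le> 18 * (6 * real k)\<^sup>2 / real (k ^ 6)"
    unfolding rate_def by (rule divide_right_mono) simp
  also have "\<dots> = 648 / (real k) ^ 4" using k by (simp add: field_simps power_numeral_reduce)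
  also have "\<dots> \<le> (26 / (real k)\<^sup>2)\<^sup>2" using k by (simp add: power_divide divide_right_mono)
  finally show ?thesis by (intro real_le_lsqrt) (auto simp: rate_nonneg)
qed

lemma even_power_above_tangent:
  fixes a b :: real
  shows "a ^ (2 * m) + real (2 * m) * a ^ (2 * m - 1) * (b - a) \<le> b ^ (2 * m)"
proof -
  have "b ^ (2 * m) - a ^ (2 * m) \<ge> (real (2 * m) * a ^ (2 * m - 1)) * (b - a)"
  proof (rule convex_on_imp_above_tangent[of UNIV])
    show "convex_on UNIV (\<lambda>x :: real. x ^ (2 * m))" by (rule convex_power_even) simp
    show "((\<lambda>x. x ^ (2 * m)) has_real_derivative real (2 * m) * a ^ (2 * m - 1)) (at a within UNIV)"
      by (auto intro!: derivative_eq_intros)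
  qed auto
  then show ?thesis by simp
qed

text \<open>
  The three terms handle \<open>\<bar>z\<bar> \<le> e\<close>, \<open>e < \<bar>z\<bar> \<le> 1 / e\<close> and \<open>\<bar>z\<bar> > 1 / e\<close>. Thus smallness in
  \<open>L\<^sup>1\<close> and bounded even moments imply smallness in \<open>L\<^sup>p\<close>, for \<open>p < 1\<close> as well.
\<close>

lemma abs_powr_le:
  fixes z :: real
  assumes e: "0 < e" "e < 1" and p: "0 < p" "p + 1 \<le> real (2 * m)"
  shows "\<bar>z\<bar> powr p \<le> e powr p + e powr (- p - 1) * \<bar>z\<bar> + e * z ^ (2 * m)"
proof -
  have n1: "0 \<le> e powr p" "0 \<le> e powr (- p - 1) * \<bar>z\<bar>" "0 \<le> e * z ^ (2 * m)"
    using e by (auto intro!: mult_nonneg_nonneg)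
  consider "\<bar>z\<bar> \<le> e" | "e < \<bar>z\<bar>" "\<bar>z\<bar> \<le> 1 / e" | "1 / e < \<bar>z\<bar>" by linarith
  then show ?thesis
  proof cases
    case 1
    then have "\<bar>z\<bar> powr p \<le> e powr p" using p by (intro powr_mono2) auto
    then show ?thesis using n1 by linarith
  next
    case 2
    have "\<bar>z\<bar> powr p \<le> (1 / e) powr p" using p 2 by (intro powr_mono2) auto
    also have "\<dots> = e powr (- p - 1) * e"
      using e by (simp add: powr_divide powr_minus powr_diff field_simps)
    also have "\<dots> \<le> e powr (- p - 1) * \<bar>z\<bar>" using 2 by (intro mult_left_mono) auto
    finally show ?thesis using n1 by linarith
  next
    case 3
    have z1: "1 < \<bar>z\<bar>" using 3 e by (smt (verit) less_divide_eq_1_pos)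
    have "\<bar>z\<bar> powr p \<le> \<bar>z\<bar> powr (real (2 * m) - 1)" using p z1 by (intro powr_mono) auto
    also have "\<dots> = \<bar>z\<bar> ^ (2 * m) / \<bar>z\<bar>"
      using z1 by (simp add: powr_diff powr_realpow[symmetric])
    also have "\<dots> = (1 / \<bar>z\<bar>) * z ^ (2 * m)" by (simp add: power_even_abs)
    also have "\<dots> \<le> e * z ^ (2 * m)"
    proof (rule mult_right_mono)
      show "1 / \<bar>z\<bar> \<le> e" using 3 e z1 by (simp add: field_simps)
      show "0 \<le> z ^ (2 * m)" by (rule zero_le_even_power) simp
    qed
    finally show ?thesis using n1 by linarith
  qed
qed

lemma (in prob_space) expectation_abs_powr_le:
  fixes Z :: "'a \<Rightarrow> real"
  assumes Z: "integrable M Z" "integrable M (\<lambda>\<omega>. Z \<omega> ^ (2 * m))"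
    and p: "0 < p" "p + 1 \<le> real (2 * m)"
  shows "integrable M (\<lambda>\<omega>. \<bar>Z \<omega>\<bar> powr p)"
    and "0 < e \<Longrightarrow> e < 1 \<Longrightarrow> expectation (\<lambda>\<omega>. \<bar>Z \<omega>\<bar> powr p)
       \<le> e powr p + e powr (- p - 1) * expectation (\<lambda>\<omega>. \<bar>Z \<omega>\<bar>) + e * expectation (\<lambda>\<omega>. Z \<omega> ^ (2 * m))"
proof -
  have [measurable]: "Z \<in> borel_measurable M" using Z by simp
  have int: "integrable M (\<lambda>\<omega>. e powr p + e powr (- p - 1) * \<bar>Z \<omega>\<bar> + e * Z \<omega> ^ (2 * m))" for e
    using Z by auto
  show *: "integrable M (\<lambda>\<omega>. \<bar>Z \<omega>\<bar> powr p)"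
  proof (rule Bochner_Integration.integrable_bound[OF int[of "1/2"]])
    show "AE \<omega> in M. norm (\<bar>Z \<omega>\<bar> powr p) \<le> norm ((1/2) powr p + (1/2) powr (- p - 1) * \<bar>Z \<omega>\<bar> + (1/2) * Z \<omega> ^ (2 * m))"
    proof (rule AE_I2)
      fix \<omega>
      show "norm (\<bar>Z \<omega>\<bar> powr p) \<le> norm ((1/2) powr p + (1/2) powr (- p - 1) * \<bar>Z \<omega>\<bar> + (1/2) * Z \<omega> ^ (2 * m))"
      proof -
        have "\<bar>Z \<omega>\<bar> powr p \<le> (1/2) powr p + (1/2) powr (- p - 1) * \<bar>Z \<omega>\<bar> + (1/2) * Z \<omega> ^ (2 * m)"
          by (rule abs_powr_le) (use p in auto)
        also have "\<dots> \<le> \<bar>\<dots>\<bar>" by simp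
        finally show ?thesis by simp
      qed
    qed
  qed measurable
  assume e: "0 < e" "e < 1"
  have "expectation (\<lambda>\<omega>. \<bar>Z \<omega>\<bar> powr p) \<le> expectation (\<lambda>\<omega>. e powr p + e powr (- p - 1) * \<bar>Z \<omega>\<bar> + e * Z \<omega> ^ (2 * m))"
    by (intro integral_mono * int abs_powr_le e p)
  also have "\<dots> = e powr p + e powr (- p - 1) * expectation (\<lambda>\<omega>. \<bar>Z \<omega>\<bar>) + e * expectation (\<lambda>\<omega>. Z \<omega> ^ (2 * m))"
    using Z by (simp add: prob_space)
  finally show "expectation (\<lambda>\<omega>. \<bar>Z \<omega>\<bar> powr p)
       \<le> e powr p + e powr (- p - 1) * expectation (\<lambda>\<omega>. \<bar>Z \<omega>\<bar>) + e * expectation (\<lambda>\<omega>. Z \<omega> ^ (2 * m))" .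
qed

lemma even_power_diff_le:
  fixes a b :: real shows "(a - b) ^ (2 * m) \<le> 2 ^ (2 * m) * (a ^ (2 * m) + b ^ (2 * m))"
proof -
  have "(a - b) ^ (2 * m) = \<bar>a - b\<bar> ^ (2 * m)" by (simp add: power_even_abs)
  also have "\<dots> \<le> (2 * max \<bar>a\<bar> \<bar>b\<bar>) ^ (2 * m)" by (intro power_mono) auto
  also have "\<dots> = 2 ^ (2 * m) * max (a ^ (2 * m)) (b ^ (2 * m))"
  proof (cases "\<bar>a\<bar> \<le> \<bar>b\<bar>")
    case True
    then have "\<bar>a\<bar> ^ (2 * m) \<le> \<bar>b\<bar> ^ (2 * m)" by (intro power_mono) auto
    then show ?thesis using True by (simp add: power_mult_distrib power_even_abs max_def)
  next
    case False
    then have "\<bar>b\<bar> ^ (2 * m) \<le> \<bar>a\<bar> ^ (2 * m)" by (intro power_mono) auto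
    then show ?thesis using False by (simp add: power_mult_distrib power_even_abs max_def)
  qed
  also have "\<dots> \<le> 2 ^ (2 * m) * (a ^ (2 * m) + b ^ (2 * m))"
    by (intro mult_left_mono) auto
  finally show ?thesis .
qed

locale harris_limit = harris_process M X for M :: "'w measure" and X +
  fixes Xinf :: "'w \<Rightarrow> vbar measure" and Y :: "'w \<Rightarrow> real"
  assumes Xinf: "doob_martin_limit M X Xinf" and Y: "is_Y_infinity M Xinf Y"
begin

lemma Y_Lp: "1 \<le> p \<Longrightarrow> tendsto_Lp M p (\<lambda>k \<omega>. real_of_ereal (Y_partial (Xinf \<omega>) k)) Y"
  using Y by (simp add: is_Y_infinity_def)

lemma Y_measurable [measurable]: "Y \<in> borel_measurable M"
  using Y_Lp[of 1] by (simp add: tendsto_Lp_def)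

lemma Y_integrable: "integrable M Y"
  using Y_Lp[of 1] by (subst integrable_abs_iff[symmetric]) (simp_all add: tendsto_Lp_def)

lemma Y_power_integrable: "1 \<le> m \<Longrightarrow> integrable M (\<lambda>\<omega>. Y \<omega> ^ (2 * m))"
proof -
  assume m: "1 \<le> m"
  have "\<bar>Y \<omega>\<bar> powr real (2 * m) = Y \<omega> ^ (2 * m)" for \<omega>
    using m powr_realpow[of "\<bar>Y \<omega>\<bar>" "2 * m"] by (cases "Y \<omega> = 0") (auto simp: power_even_abs)
  then show ?thesis using Y_Lp[of "real (2 * m)"] m by (simp add: tendsto_Lp_def)
qed

lemma R_integrable: "1 \<le> n \<Longrightarrow> integrable M (R k n)"
  using integrable_X[of n "\<lambda>x. residual k x / real n"] by (simp add: R_def[abs_def])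

text \<open>
  The partial sums converge to \<open>Y\<close> in \<open>L\<^sup>1\<close>, so \<open>k\<close> can be sent to infinity in the previous bound.
\<close>

lemma R_L1:
  assumes n: "1 \<le> n"
  shows "expectation (\<lambda>\<omega>. \<bar>R 0 n \<omega> - Y \<omega>\<bar>) \<le> sqrt (rate n)"
proof -
  define V where "V k \<omega> = real_of_ereal (Y_partial (Xinf \<omega>) k)" for k \<omega>
  have V: "integrable M (V k)" for k
    using Y_Lp[of 1] unfolding V_def[symmetric]
    by (subst integrable_abs_iff[symmetric]) (simp_all add: tendsto_Lp_def)
  have VY: "(\<lambda>k. expectation (\<lambda>\<omega>. \<bar>V k \<omega> - Y \<omega>\<bar>)) \<longlonglongrightarrow> 0"
    using Y_Lp[of 1] unfolding V_def[symmetric] by (simp add: tendsto_Lp_def)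
  have RV: "expectation (\<lambda>\<omega>. \<bar>R 0 n \<omega> - V k \<omega>\<bar>) \<le> sqrt (rate n) + sqrt (rate (Suc k))" for k
  proof -
    have "ennreal (expectation (\<lambda>\<omega>. \<bar>R 0 n \<omega> - V k \<omega>\<bar>)) = (\<integral>\<^sup>+\<omega>. ennreal \<bar>R 0 n \<omega> - V k \<omega>\<bar> \<partial>M)"
      using V R_integrable[OF n] by (intro nn_integral_eq_integral[symmetric]) auto
    also have "\<dots> \<le> ennreal (sqrt (rate n) + sqrt (rate (Suc k)))"
      unfolding V_def by (rule nn_integral_Y_partial[OF Xinf n])
    finally show ?thesis
      by (rule ennreal_le_iff[THEN iffD1, rotated]) (simp add: rate_nonneg)
  qed
  have "(\<lambda>k. sqrt (rate n) + sqrt (rate (Suc k)) + expectation (\<lambda>\<omega>. \<bar>V k \<omega> - Y \<omega>\<bar>)) \<longlonglongrightarrow> sqrt (rate n) + sqrt 0 + 0"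
    by (intro tendsto_intros VY LIMSEQ_Suc rate_tendsto)
  moreover have "expectation (\<lambda>\<omega>. \<bar>R 0 n \<omega> - Y \<omega>\<bar>)
      \<le> sqrt (rate n) + sqrt (rate (Suc k)) + expectation (\<lambda>\<omega>. \<bar>V k \<omega> - Y \<omega>\<bar>)" for k
  proof -
    have "expectation (\<lambda>\<omega>. \<bar>R 0 n \<omega> - Y \<omega>\<bar>) \<le> expectation (\<lambda>\<omega>. \<bar>R 0 n \<omega> - V k \<omega>\<bar> + \<bar>V k \<omega> - Y \<omega>\<bar>)"
      using V R_integrable[OF n] Y_integrable by (intro integral_mono) auto
    also have "\<dots> = expectation (\<lambda>\<omega>. \<bar>R 0 n \<omega> - V k \<omega>\<bar>) + expectation (\<lambda>\<omega>. \<bar>V k \<omega> - Y \<omega>\<bar>)"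
      using V R_integrable[OF n] Y_integrable by (intro Bochner_Integration.integral_add) auto
    finally show ?thesis using RV[of k] by simp
  qed
  ultimately have "expectation (\<lambda>\<omega>. \<bar>R 0 n \<omega> - Y \<omega>\<bar>) \<le> sqrt (rate n) + sqrt 0 + 0"
    by (intro LIMSEQ_le_const) auto
  then show ?thesis by simp
qed

lemma R_eq:
  assumes "1 \<le> n" "\<omega> \<in> space M"
  shows "R 0 n \<omega> = real (TPL (X n \<omega>)) / real n - harm n + 1"
  using assms X_card[OF assms]
  by (simp add: R_def residual_def small_nodes_def centred_TPL_def nharm_def field_simps)

lemma TPL_mono: "AE \<omega> in M. \<forall>m n. 1 \<le> m \<longrightarrow> m \<le> n \<longrightarrow> TPL (X m \<omega>) \<le> TPL (X n \<omega>)"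
  using X_mono_AE AE_space
proof eventually_elim
  case (elim \<omega>)
  have "X m \<omega> \<subseteq> X n \<omega>" if "1 \<le> m" "m \<le> n" for m n
    using that(2) by (induction rule: dec_induct) (use elim that in \<open>auto dest: order_trans\<close>)
  then show ?case
    using harris_tree_finite[OF X_tree] elim by (auto simp: TPL_def intro!: sum_mono2)
qed

lemma convergence_AE: "AE \<omega> in M. (\<lambda>n. real (TPL (X n \<omega>)) / real n - harm n + 1) \<longlonglongrightarrow> Y \<omega>"
proof -
  define D where "D k \<omega> = \<bar>R 0 (Suc k ^ 6) \<omega> - Y \<omega>\<bar>" for k \<omega>
  have one: "1 \<le> Suc k ^ 6" for k by simp
  have D: "integrable M (D k)" for k
    unfolding D_def using R_integrable[OF one] Y_integrable by auto
  have [measurable]: "D k \<in> borel_measurable M" for k using D by simp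
  have ED: "expectation (D k) \<le> 26 / (real (Suc k))\<^sup>2" for k
    unfolding D_def by (rule order_trans[OF R_L1[OF one] sqrt_rate_le]) simp
  have sm: "summable (\<lambda>k. 26 / (real (Suc k))\<^sup>2)"
  proof -
    have "summable (\<lambda>k. inverse ((real (Suc k))\<^sup>2))"
      using inverse_power_summable[of 2, where 'a = real] by (subst summable_Suc_iff) simp
    then show ?thesis using summable_mult[of _ 26] by (simp add: divide_inverse)
  qed
  have "(\<integral>\<^sup>+\<omega>. (\<Sum>k. ennreal (D k \<omega>)) \<partial>M) = (\<Sum>k. \<integral>\<^sup>+\<omega>. ennreal (D k \<omega>) \<partial>M)"
    by (rule nn_integral_suminf) simp
  also have "\<dots> = (\<Sum>k. ennreal (expectation (D k)))"
    by (intro suminf_cong nn_integral_eq_integral D) (auto simp: D_def)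
  also have "\<dots> \<le> (\<Sum>k. ennreal (26 / (real (Suc k))\<^sup>2))"
    by (intro suminf_le ennreal_leI ED) auto
  also have "\<dots> < top" using sm by (subst suminf_ennreal2) auto
  finally have "(\<integral>\<^sup>+\<omega>. (\<Sum>k. ennreal (D k \<omega>)) \<partial>M) \<noteq> \<infinity>" by simp
  then have "AE \<omega> in M. (\<Sum>k. ennreal (D k \<omega>)) \<noteq> \<infinity>"
    by (intro nn_integral_noteq_infinite) auto
  then show ?thesis using TPL_mono AE_space
  proof eventually_elim
    case (elim \<omega>)
    have "summable (\<lambda>k. D k \<omega>)"
      using elim(1) by (intro summable_suminf_not_top) (auto simp: D_def)
    then have "(\<lambda>k. D k \<omega>) \<longlonglongrightarrow> 0" by (rule summable_LIMSEQ_zero)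
    then have "(\<lambda>k. R 0 (Suc k ^ 6) \<omega> - Y \<omega>) \<longlonglongrightarrow> 0" unfolding D_def by (rule tendsto_rabs_zero_cancel)
    then have "(\<lambda>k. R 0 (Suc k ^ 6) \<omega>) \<longlonglongrightarrow> Y \<omega>" by (rule LIM_zero_cancel)
    then have lim: "(\<lambda>k. real (TPL (X (Suc k ^ 6) \<omega>)) / real (Suc k ^ 6) - harm (Suc k ^ 6) + 1) \<longlonglongrightarrow> Y \<omega>"
      using R_eq[OF one elim(3)] by simp
    show ?case
      by (rule monotone_interpolation[OF _ _ lim]) (use elim in auto)
  qed
qed

text \<open>
  The left side is the limit of the constant sequence of expectations of \<open>g (X n)\<close> times the martingale at
  later times. In other words, the martingale at time \<open>n\<close> is the conditional expectation of \<open>Y\<close> given \<open>X n\<close>.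
\<close>

lemma martingale_closed:
  assumes n: "1 \<le> n"
  shows "expectation (\<lambda>\<omega>. g (X n \<omega>) * Y \<omega>) = expectation (\<lambda>\<omega>. g (X n \<omega>) * R 0 n \<omega>)"
    and "integrable M (\<lambda>\<omega>. g (X n \<omega>) * Y \<omega>)"
proof -
  define C where "C = (\<Sum>x\<in>harris_trees n. \<bar>g x\<bar>)"
  have C: "\<bar>g (X n \<omega>)\<bar> \<le> C" if "\<omega> \<in> space M" for \<omega>
    unfolding C_def by (rule member_le_sum) (use X_mem[OF n that] finite_harris_trees in auto)
  have gm[measurable]: "(\<lambda>\<omega>. g (X n \<omega>)) \<in> borel_measurable M" by (rule measurable_X[OF n])
  have gint: "integrable M (\<lambda>\<omega>. g (X n \<omega>) * Z \<omega>)" if Z: "integrable M Z" for Z :: "'w \<Rightarrow> real"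
  proof (rule Bochner_Integration.integrable_bound)
    show "integrable M (\<lambda>\<omega>. C * Z \<omega>)" using Z by simp
    show "(\<lambda>\<omega>. g (X n \<omega>) * Z \<omega>) \<in> borel_measurable M" using Z by measurable
    show "AE \<omega> in M. norm (g (X n \<omega>) * Z \<omega>) \<le> norm (C * Z \<omega>)"
      using AE_space by eventually_elim (auto simp: abs_mult intro!: mult_right_mono order_trans[OF C])
  qed
  show "integrable M (\<lambda>\<omega>. g (X n \<omega>) * Y \<omega>)" by (rule gint[OF Y_integrable])
  let ?e = "\<lambda>Z. expectation (\<lambda>\<omega>. g (X n \<omega>) * Z \<omega>)"
  have bound: "\<bar>?e (R 0 n) - ?e Y\<bar> \<le> C * sqrt (rate m)" if m: "n \<le> m" for m
  proof -
    have m1: "1 \<le> m" using m n by simp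
    have "?e (R 0 n) = ?e (R 0 m)"
      using harmonic_martingale[OF harmonic_residual n m, of g] by (simp add: R_def)
    then have "?e (R 0 n) - ?e Y = ?e (\<lambda>\<omega>. R 0 m \<omega> - Y \<omega>)"
      using gint R_integrable[OF m1] Y_integrable by (simp add: right_diff_distrib)
    also have "\<bar>\<dots>\<bar> \<le> expectation (\<lambda>\<omega>. \<bar>g (X n \<omega>) * (R 0 m \<omega> - Y \<omega>)\<bar>)" by (rule integral_abs_bound)
    also have "\<dots> \<le> expectation (\<lambda>\<omega>. C * \<bar>R 0 m \<omega> - Y \<omega>\<bar>)"
      using R_integrable[OF m1] Y_integrable
      by (intro integral_mono integrable_abs gint) (auto simp: abs_mult intro!: mult_right_mono C)
    also have "\<dots> = C * expectation (\<lambda>\<omega>. \<bar>R 0 m \<omega> - Y \<omega>\<bar>)" by simp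
    also have "\<dots> \<le> C * sqrt (rate m)"
      by (intro mult_left_mono R_L1 m1) (auto simp: C_def intro!: sum_nonneg)
    finally show ?thesis .
  qed
  have "(\<lambda>m. C * sqrt (rate m)) \<longlonglongrightarrow> C * sqrt 0" by (intro tendsto_intros rate_tendsto)
  then have "\<bar>?e (R 0 n) - ?e Y\<bar> \<le> C * sqrt 0"
    by (rule LIMSEQ_le_const) (use bound in auto)
  then show "?e Y = ?e (R 0 n)" by simp
qed

lemma R_power_integrable: "1 \<le> n \<Longrightarrow> integrable M (\<lambda>\<omega>. R 0 n \<omega> ^ m)"
  using integrable_X[of n "\<lambda>x. (residual 0 x / real n) ^ m"] by (simp add: R_def)

text \<open>
  Jensen's inequality for the conditional expectation, proved with the tangent at the martingale value. The
  linear term has expectation zero because the martingale is closed by \<open>Y\<close>.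
\<close>

lemma R_moment_le:
  assumes n: "1 \<le> n" and m: "1 \<le> m"
  shows "expectation (\<lambda>\<omega>. R 0 n \<omega> ^ (2 * m)) \<le> expectation (\<lambda>\<omega>. Y \<omega> ^ (2 * m))"
proof -
  define g where "g x = real (2 * m) * (residual 0 x / real n) ^ (2 * m - 1)" for x
  have gX: "g (X n \<omega>) = real (2 * m) * R 0 n \<omega> ^ (2 * m - 1)" for \<omega> by (simp add: g_def R_def)
  have gR: "integrable M (\<lambda>\<omega>. g (X n \<omega>) * R 0 n \<omega>)"
    using integrable_X[OF n, of "\<lambda>x. g x * (residual 0 x / real n)"] by (simp add: R_def)
  note mc = martingale_closed[OF n, of g]
  have "expectation (\<lambda>\<omega>. R 0 n \<omega> ^ (2 * m)) = expectation (\<lambda>\<omega>. R 0 n \<omega> ^ (2 * m) + (g (X n \<omega>) * Y \<omega> - g (X n \<omega>) * R 0 n \<omega>))"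
    using mc gR R_power_integrable[OF n] by simp
  also have "\<dots> \<le> expectation (\<lambda>\<omega>. Y \<omega> ^ (2 * m))"
  proof (rule integral_mono)
    fix \<omega>
    show "R 0 n \<omega> ^ (2 * m) + (g (X n \<omega>) * Y \<omega> - g (X n \<omega>) * R 0 n \<omega>) \<le> Y \<omega> ^ (2 * m)"
      using even_power_above_tangent[of "R 0 n \<omega>" m "Y \<omega>"] by (simp add: gX right_diff_distrib)
  qed (use mc gR R_power_integrable[OF n] Y_power_integrable[OF m] in auto)
  finally show ?thesis .
qed

lemma convergence_Lp:
  assumes p: "0 < p"
  shows "tendsto_Lp M p (\<lambda>n \<omega>. real (TPL (X n \<omega>)) / real n - harm n + 1) Y"
proof -
  let ?F = "\<lambda>n \<omega>. real (TPL (X n \<omega>)) / real n - harm n + 1"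
  obtain m :: nat where m: "p + 1 \<le> real (2 * m)" "1 \<le> m"
  proof
    show "p + 1 \<le> real (2 * Suc (nat \<lceil>p\<rceil>))" by simp linarith
  qed simp
  have F_R: "?F n \<omega> = R 0 n \<omega>" if "1 \<le> n" "\<omega> \<in> space M" for n \<omega> using R_eq[OF that] by simp
  have F_meas: "?F n \<in> borel_measurable M" and F_int: "integrable M (\<lambda>\<omega>. \<bar>?F n \<omega>\<bar> powr p)" for n
  proof -
    have "?F n \<in> borel_measurable M \<and> integrable M (\<lambda>\<omega>. \<bar>?F n \<omega>\<bar> powr p)"
    \<comment> \<open>at \<open>n = 0\<close> the process is the constant 1, whatever \<open>X 0\<close> is\<close>
    proof (cases "n = 0")
      case False
      then have n: "1 \<le> n" by simp
      show ?thesis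
        using measurable_X[OF n, of "\<lambda>x. real (TPL x) / real n - harm n + 1"]
          integrable_X[OF n, of "\<lambda>x. \<bar>real (TPL x) / real n - harm n + 1\<bar> powr p"] by simp
    qed (simp add: harm_expand)
    then show "?F n \<in> borel_measurable M" "integrable M (\<lambda>\<omega>. \<bar>?F n \<omega>\<bar> powr p)" by auto
  qed
  have Yp: "integrable M (\<lambda>\<omega>. \<bar>Y \<omega>\<bar> powr p)"
    by (rule expectation_abs_powr_le(1)[OF Y_integrable Y_power_integrable[OF m(2)] p m(1)])
  define K where "K = 2 ^ (2 * m) * (2 * expectation (\<lambda>\<omega>. Y \<omega> ^ (2 * m)))"
  have K0: "0 \<le> K" unfolding K_def by (intro mult_nonneg_nonneg integral_nonneg_AE) auto
  have bound: "expectation (\<lambda>\<omega>. \<bar>?F n \<omega> - Y \<omega>\<bar> powr p) \<le> e powr p + e powr (- p - 1) * sqrt (rate n) + e * K"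
    if n: "1 \<le> n" and e: "0 < e" "e < 1" for n e
  proof -
    let ?Z = "\<lambda>\<omega>. R 0 n \<omega> - Y \<omega>"
    have Z: "integrable M ?Z" using R_integrable[OF n] Y_integrable by simp
    have dom: "integrable M (\<lambda>\<omega>. 2 ^ (2 * m) * (R 0 n \<omega> ^ (2 * m) + Y \<omega> ^ (2 * m)))"
      using R_power_integrable[OF n] Y_power_integrable[OF m(2)] by simp
    have Zm: "integrable M (\<lambda>\<omega>. ?Z \<omega> ^ (2 * m))"
    proof (rule Bochner_Integration.integrable_bound[OF dom])
      have [measurable]: "?Z \<in> borel_measurable M" using Z by simp
      show "(\<lambda>\<omega>. ?Z \<omega> ^ (2 * m)) \<in> borel_measurable M" by measurable
      show "AE \<omega> in M. norm (?Z \<omega> ^ (2 * m)) \<le> norm (2 ^ (2 * m) * (R 0 n \<omega> ^ (2 * m) + Y \<omega> ^ (2 * m)))"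
        using even_power_diff_le[of "R 0 n _" "Y _" m] by (intro AE_I2) simp
    qed
    have "expectation (\<lambda>\<omega>. ?Z \<omega> ^ (2 * m)) \<le> expectation (\<lambda>\<omega>. 2 ^ (2 * m) * (R 0 n \<omega> ^ (2 * m) + Y \<omega> ^ (2 * m)))"
      by (intro integral_mono Zm dom even_power_diff_le)
    also have "\<dots> = 2 ^ (2 * m) * (expectation (\<lambda>\<omega>. R 0 n \<omega> ^ (2 * m)) + expectation (\<lambda>\<omega>. Y \<omega> ^ (2 * m)))"
      using R_power_integrable[OF n] Y_power_integrable[OF m(2)] by simp
    also have "\<dots> \<le> K" unfolding K_def using R_moment_le[OF n m(2)] by (intro mult_left_mono) auto
    finally have ZK: "expectation (\<lambda>\<omega>. ?Z \<omega> ^ (2 * m)) \<le> K" .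
    have "expectation (\<lambda>\<omega>. \<bar>?F n \<omega> - Y \<omega>\<bar> powr p) = expectation (\<lambda>\<omega>. \<bar>?Z \<omega>\<bar> powr p)"
      by (intro Bochner_Integration.integral_cong refl) (simp add: F_R[OF n])
    also have "\<dots> \<le> e powr p + e powr (- p - 1) * expectation (\<lambda>\<omega>. \<bar>?Z \<omega>\<bar>) + e * expectation (\<lambda>\<omega>. ?Z \<omega> ^ (2 * m))"
      by (rule expectation_abs_powr_le(2)[OF Z Zm p m(1) e])
    also have "\<dots> \<le> e powr p + e powr (- p - 1) * sqrt (rate n) + e * K"
      using ZK e by (intro add_mono mult_left_mono R_L1[OF n]) auto
    finally show ?thesis .
  qed
  have "(\<lambda>n. expectation (\<lambda>\<omega>. \<bar>?F n \<omega> - Y \<omega>\<bar> powr p)) \<longlonglongrightarrow> 0"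
  proof (rule tendstoI)
    fix d :: real assume d: "0 < d"
    have "((\<lambda>e. e powr p + e * K) \<longlongrightarrow> 0 powr p + 0 * K) (at_right 0)"
      by (intro tendsto_intros) (use p in \<open>auto simp: eventually_at_filter\<close>)
    then have "((\<lambda>e. e powr p + e * K) \<longlongrightarrow> 0) (at_right 0)" using p by simp
    then have "\<forall>\<^sub>F e in at_right 0. e powr p + e * K < d / 2"
      by (rule order_tendstoD(2)) (use d in simp)
    moreover have "\<forall>\<^sub>F e in at_right (0::real). 0 < e \<and> e < 1"
      using eventually_at_right_real[of 0 1] by (auto elim: eventually_mono)
    ultimately have "\<forall>\<^sub>F e in at_right 0. e powr p + e * K < d / 2 \<and> 0 < e \<and> e < 1"
      by eventually_elim auto
    then obtain e where e: "e powr p + e * K < d / 2" "0 < e" "e < 1"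
      using eventually_happens'[OF trivial_limit_at_right_real] by blast
    have "(\<lambda>n. e powr (- p - 1) * sqrt (rate n)) \<longlonglongrightarrow> e powr (- p - 1) * sqrt 0"
      by (intro tendsto_intros rate_tendsto)
    then have "(\<lambda>n. e powr (- p - 1) * sqrt (rate n)) \<longlonglongrightarrow> 0" by simp
    then have "\<forall>\<^sub>F n in sequentially. e powr (- p - 1) * sqrt (rate n) < d / 2"
      by (rule order_tendstoD(2)) (use d in simp)
    then show "\<forall>\<^sub>F n in sequentially. dist (expectation (\<lambda>\<omega>. \<bar>?F n \<omega> - Y \<omega>\<bar> powr p)) 0 < d"
      using eventually_ge_at_top[of 1]
    proof eventually_elim
      case (elim n)
      have "0 \<le> expectation (\<lambda>\<omega>. \<bar>?F n \<omega> - Y \<omega>\<bar> powr p)" by (intro integral_nonneg_AE) auto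
      then show ?case using bound[OF elim(2) e(2,3)] elim(1) e(1) by (simp only: dist_real_def)
    qed
  qed
  then show ?thesis using F_meas F_int Yp Y_measurable by (simp add: tendsto_Lp_def)
qed

end

theorem theorem10:
  fixes M :: "'w measure"
    and X :: "nat \<Rightarrow> 'w \<Rightarrow> nat list set"
    and Xinf :: "'w \<Rightarrow> vbar measure"
    and Y :: "'w \<Rightarrow> real"
  assumes "harris_chain M X"
    and "doob_martin_limit M X Xinf"
    and "is_Y_infinity M Xinf Y"
  shows "(AE \<omega> in M. (\<lambda>n. real (TPL (X n \<omega>)) / real n - harm n + 1) \<longlonglongrightarrow> Y \<omega>) \<and>
         (\<forall>p>0. tendsto_Lp M p (\<lambda>n \<omega>. real (TPL (X n \<omega>)) / real n - harm n + 1) Y)"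
proof -
  interpret prob_space M using assms(1) by (simp add: harris_chain_def)
  interpret harris_limit M X Xinf Y by unfold_locales (use assms in auto)
  show ?thesis using convergence_AE convergence_Lp by blast
qed

end
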